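(* Let $X$ be a compact metric space and let $f:X\to X$ be a continuous map with the exponential specification property. Let $A:X\to GL(m,\mathbb{R})$ be an $\alpha$-H\"older continuous function for some $\alpha>0$. Suppose that $$\inf_{\mu\in\mathcal{M}^e_f(X)}\chi_{max}(A,\mu)<\sup_{\mu\in\mathcal{M}^e_f(X)}\chi_{max}(A,\mu).$$ Then the Max-Lyapunov-irregular set $MLI(A,f)$ contains an uncountable DC1-scrambled set.
   Context: Cocycle: for $n>0$, $A(x,n):=A(f^{n-1}x)\cdots A(fx)A(x)$. $\mathcal{M}^e_f(X)$ denotes the set of ergodic $f$-invariant Borel probability measures on $X$. For $x\in X$, the maximal Lyapunov exponent is $\chi_{max}(A,x)=\lim_{n\to\infty}\frac1n\log\|A(x,n)\|$ when the limit exists; $x$ is then Max-Lyapunov-regular, and otherwise Max-Lyapunov-irregular. $MLI(A,f)$ is the set of Max-Lyapunov-irregular points. For $\mu\in\mathcal{M}^e_f(X)$, $\chi_{max}(A,\mu)$ is the constant value of $\chi_{max}(A,x)$ for $\mu$-a.e. $x$ (which exists by Kingman's subadditive ergodic theorem). Exponential specification: for $x\in X$, $\delta>0$, $\lambda>0$, $n\ge 0$, let $B_n(x,\delta,\lambda)=\{y\in X: d(f^ix,f^iy)<\delta e^{-\lambda\min\{i,n-i\}} \text{ for all } 0\le i\le n\}$. The map $f$ has the exponential specification property (with some exponent $\lambda>0$ depending only on $f$) if for every $\delta>0$ there is a positive integer $N=N(\delta)$ such that for every $k\ge1$, all points $x_1,\dots,x_k\in X$ and all nonnegative integer sequences $\{N_i\}_{i=1}^k,\{M_i\}_{i=1}^k$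 with $N_1=0$ and $N_j\ge N_{j-1}+M_{j-1}+N$ for $2\le j\le k$, the set $\bigcap_{i=1}^k f^{-N_i}B_{M_i}(x_i,\delta,\lambda)$ is nonempty. DC1: a pair $x,y\in X$ is DC1-scrambled if for every $t>0$, $\limsup_{n\to\infty}\frac1n|\{i\in[0,n-1]: d(f^ix,f^iy)<t\}|=1$, and there exists $t_0>0$ with $\liminf_{n\to\infty}\frac1n|\{i\in[0,n-1]: d(f^ix,f^iy)<t_0\}|=0$. A set $S\subseteq X$ is DC1-scrambled if every pair of distinct points of $S$ is DC1-scrambled. *)

theory Defs
  imports "HOL-Probability.Probability"
begin

text \<open>The compact metric space X is the (compact) carrier type 'a.
  Matrices in GL(m,R) are invertible elements of real^'m^'m.\<close>

definition opnorm :: "real^'m^'m \<Rightarrow> real" where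
  "opnorm M = onorm (\<lambda>v. M *v v)"

primrec cocycle :: "('a \<Rightarrow> real^'m^'m) \<Rightarrow> ('a \<Rightarrow> 'a) \<Rightarrow> nat \<Rightarrow> 'a \<Rightarrow> real^'m^'m" where
  "cocycle A f 0 x = mat 1"
| "cocycle A f (Suc n) x = A ((f ^^ n) x) ** cocycle A f n x"

definition lyap_seq :: "('a \<Rightarrow> real^'m^'m) \<Rightarrow> ('a \<Rightarrow> 'a) \<Rightarrow> 'a \<Rightarrow> nat \<Rightarrow> real" where
  "lyap_seq A f x n = ln (opnorm (cocycle A f n x)) / real n"

definition MLI :: "('a \<Rightarrow> real^'m^'m) \<Rightarrow> ('a \<Rightarrow> 'a) \<Rightarrow> 'a set" where
  "MLI A f = {x. \<not> convergent (lyap_seq A f x)}"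

definition invariant_measure :: "('a::metric_space \<Rightarrow> 'a) \<Rightarrow> 'a measure \<Rightarrow> bool" where
  "invariant_measure f M \<longleftrightarrow> prob_space M \<and> sets M = sets borel \<and>
     f \<in> M \<rightarrow>\<^sub>M M \<and> distr M M f = M"

definition ergodic_measure :: "('a::metric_space \<Rightarrow> 'a) \<Rightarrow> 'a measure \<Rightarrow> bool" where
  "ergodic_measure f M \<longleftrightarrow> invariant_measure f M \<and>
     (\<forall>B\<in>sets M. f -` B = B \<longrightarrow> measure M B = 0 \<or> measure M B = 1)"

definition chi_max_measure :: "('a \<Rightarrow> real^'m^'m) \<Rightarrow> ('a \<Rightarrow> 'a) \<Rightarrow> 'a measure \<Rightarrow> real" where
  "chi_max_measure A f M = (THE c. AE x in M. lyap_seq A f x \<longlonglongrightarrow> c)"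

definition bowen_ball :: "('a::metric_space \<Rightarrow> 'a) \<Rightarrow> 'a \<Rightarrow> real \<Rightarrow> real \<Rightarrow> nat \<Rightarrow> 'a set" where
  "bowen_ball f x \<delta> lam n = {y. \<forall>i\<le>n. dist ((f ^^ i) x) ((f ^^ i) y) < \<delta> * exp (- lam * real (min i (n - i)))}"

definition exp_specification :: "('a::metric_space \<Rightarrow> 'a) \<Rightarrow> bool" where
  "exp_specification f \<longleftrightarrow> (\<exists>lam>0. \<forall>\<delta>>0. \<exists>N::nat. N > 0 \<and>
     (\<forall>k::nat. \<forall>xs::nat \<Rightarrow> 'a. \<forall>Ns Ms :: nat \<Rightarrow> nat.
        k \<ge> 1 \<longrightarrow> Ns 1 = 0 \<longrightarrow>
        (\<forall>j. 2 \<le> j \<and> j \<le> k \<longrightarrow> Ns j \<ge> Ns (j - 1) + Ms (j - 1) + N) \<longrightarrow>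
        (\<Inter>i\<in>{1..k}. (f ^^ Ns i) -` bowen_ball f (xs i) \<delta> lam (Ms i)) \<noteq> {}))"

definition DC1_pair :: "('a::metric_space \<Rightarrow> 'a) \<Rightarrow> 'a \<Rightarrow> 'a \<Rightarrow> bool" where
  "DC1_pair f x y \<longleftrightarrow>
     (\<forall>t>0. limsup (\<lambda>n. ereal (real (card {i\<in>{0..<n}. dist ((f ^^ i) x) ((f ^^ i) y) < t}) / real n)) = 1) \<and>
     (\<exists>t0>0. liminf (\<lambda>n. ereal (real (card {i\<in>{0..<n}. dist ((f ^^ i) x) ((f ^^ i) y) < t0}) / real n)) = 0)"

definition DC1_scrambled :: "('a::metric_space \<Rightarrow> 'a) \<Rightarrow> 'a set \<Rightarrow> bool" where
  "DC1_scrambled f S \<longleftrightarrow> (\<forall>x\<in>S. \<forall>y\<in>S. x \<noteq> y \<longrightarrow> DC1_pair f x y)"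

end

theory Submission
  imports Defs
begin

text \<open>Let \<phi> n x be the logarithm of the norm of A(x,n) and let \<beta> be the limit of max \<phi> n / n. If the integral of
  \<phi> N is at least \<beta> N for every N and every ergodic measure, then \<phi> n / n converges to \<beta> almost
  everywhere for all of them, contradicting the hypothesis. So \<phi> N has integral below \<beta> N for some N and some
  ergodic measure, which gives, for every length, orbit segments along which \<phi> grows at a rate a < \<beta>, robustly
  under uniform shadowing, by subadditivity. For b < \<beta> close to \<beta> there are arbitrarily long segments with
  growth rate b, robustly under exponential shadowing: the segment is chosen such that the normalised norm is maximal
  among all its subsegments, while the norm of any product is bounded by a slowly growing exponential,
  so the Hoelder errors of a hybrid product sum up to a small fraction of the norm.

  Specification also provides two orbits u, v staying a positive distance apart. Points following
  successively, on rapidly growing blocks and with errors tending to 0, fast segments, slow segments, and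
  the orbit of u or of v according to the bits of a 0-1 sequence are irregular; two of them are close
  along the fast blocks and far apart along infinitely many blocks of the last kind.\<close>

text \<open>The two kinds of segments are not symmetric. Slow growth reduces, by subadditivity, to
  Birkhoff sums of the single continuous function \<phi> N, so uniform closeness preserves it. Fast
  growth has no such reduction: cancellation can destroy the norm of a product, and when one factor
  is replaced, the norms of the two outer products may multiply to far more than the norm of the
  whole. On a dominated segment the longer outer product costs at most a constant times the norm of
  the whole. The shorter one, of length i, costs about exp (2 * (\<beta> - b) * i) after
  normalisation by the rate b, while the Hoelder error at that place is about exp (- lam * \<alpha>
  * i). The condition \<beta> - b \<le> lam * \<alpha> / 4 makes the products of the two summable;
  this is where the exponential form of specification enters. Proximality requires shadowing errors
  that tend to 0, but the gap in the specification property depends on the error. Infinitely many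
  blocks are therefore glued one at a time, each with its own gap.\<close>

lemma continuous_on_funpow:
  fixes f :: "'a::topological_space \<Rightarrow> 'a"
  assumes "continuous_on UNIV f"
  shows "continuous_on UNIV (f ^^ n)"
  by (induction n) (auto intro: continuous_on_compose2[OF assms] continuous_on_id)

lemma tendsto_funpow:
  fixes f :: "'a::topological_space \<Rightarrow> 'a"
  assumes "continuous_on UNIV f" "X \<longlonglongrightarrow> y"
  shows "(\<lambda>n. (f ^^ k) (X n)) \<longlonglongrightarrow> (f ^^ k) y"
  using continuous_on_tendsto_compose[OF continuous_on_funpow[OF assms(1)] assms(2)] by simp

section \<open>Existence of ergodic measures\<close>

lemma Inter_decseq_closed_nonempty:
  fixes S :: "nat \<Rightarrow> 'a::topological_space set"
  assumes "compact (S 0)" "\<And>n. closed (S n)" "\<And>n. S n \<noteq> {}" "decseq S"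
  shows "(\<Inter>n. S n) \<noteq> {}"
proof -
  have "S 0 \<inter> \<Inter>(S ` UNIV) \<noteq> {}"
  proof (rule compact_imp_fip_image[OF assms(1)])
    fix I :: "nat set" assume I: "finite I"
    have "S (Max (insert 0 I)) \<subseteq> S i" if "i \<in> insert 0 I" for i
      using I that by (intro decseqD[OF assms(4)] Max_ge) auto
    then have "S (Max (insert 0 I)) \<subseteq> S 0 \<inter> \<Inter>(S ` I)" by blast
    then show "S 0 \<inter> \<Inter>(S ` I) \<noteq> {}" using assms(3) by blast
  qed (use assms in auto)
  then show ?thesis by auto
qed

text \<open>A mean is a function on all subsets, restricted outside \<C> only by the bounds and the
  value at Z. It is thus a point of a product of unit intervals, and every condition is closed. The
  tolerance \<epsilon> admits averages over finite pieces of orbits.\<close>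

definition approx_invariant_means ::
    "'z set \<Rightarrow> 'z set set \<Rightarrow> ('z \<Rightarrow> 'z) \<Rightarrow> real \<Rightarrow> ('z set \<Rightarrow> real) set" where
  "approx_invariant_means Z \<C> \<sigma> \<epsilon> = {m. (\<forall>C. 0 \<le> m C \<and> m C \<le> 1) \<and> m Z = 1 \<and>
     (\<forall>B C. B \<in> \<C> \<longrightarrow> C \<in> \<C> \<longrightarrow> B \<inter> C = {} \<longrightarrow> m (B \<union> C) = m B + m C) \<and>
     (\<forall>C. C \<in> \<C> \<longrightarrow> \<bar>m (\<sigma> -` C \<inter> Z) - m C\<bar> \<le> \<epsilon>)}"

lemma compact_unit_functions: "compact {m :: 'b \<Rightarrow> real. \<forall>C. 0 \<le> m C \<and> m C \<le> 1}"
proof -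
  have "compactin (product_topology (\<lambda>_::'b. euclidean) UNIV) (PiE UNIV (\<lambda>_. {0..1::real}))"
    by (simp add: compactin_PiE)
  then show ?thesis
    by (simp add: euclidean_product_topology PiE_UNIV_domain Pi_def)
qed

lemma compact_closed_unit_functions:
  assumes "closed K" "K \<subseteq> {m :: 'b \<Rightarrow> real. \<forall>C. 0 \<le> m C \<and> m C \<le> 1}"
  shows "compact K"
  using compact_Int_closed[OF compact_unit_functions assms(1)] assms(2) by (simp add: Int_absorb1)

lemma closed_approx_invariant_means: "closed (approx_invariant_means Z \<C> \<sigma> \<epsilon>)"
  unfolding approx_invariant_means_def
  by (intro closed_Collect_conj closed_Collect_all closed_Collect_le closed_Collect_eq
      closed_Collect_imp open_Collect_const continuous_intros continuous_on_product_coordinates)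

text \<open>The Krylov-Bogolyubov argument: for the average over n + 1 points of an orbit the effect
  of the shift telescopes to two boundary terms, an error of at most 1 / (n + 1). A common point of
  the nested sets for these tolerances exists by compactness and is exactly invariant.\<close>

lemma invariant_mean_exists:
  assumes \<sigma>: "\<sigma> \<in> Z \<rightarrow> Z" and "Z \<noteq> {}"
  shows "approx_invariant_means Z \<C> \<sigma> 0 \<noteq> {}"
proof -
  define S where "S n = approx_invariant_means Z \<C> \<sigma> (1 / real (Suc n))" for n
  obtain z where z: "z \<in> Z" using assms by auto
  have orb: "(\<sigma> ^^ i) z \<in> Z" for i using \<sigma> z by (induction i) auto
  have ne: "S n \<noteq> {}" for n
  proof -
    define m :: "'a set \<Rightarrow> real" where "m C = (\<Sum>i<Suc n. indicator C ((\<sigma> ^^ i) z)) / real (Suc n)" for C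
    have "m \<in> S n" unfolding S_def approx_invariant_means_def
    proof (intro CollectI conjI allI impI)
      fix C
      show "0 \<le> m C" by (simp add: m_def sum_nonneg)
      have "(\<Sum>i<Suc n. indicator C ((\<sigma> ^^ i) z)) \<le> (\<Sum>i<Suc n. 1::real)"
        by (intro sum_mono) (simp add: indicator_def)
      then show "m C \<le> 1" unfolding m_def by (simp del: sum.lessThan_Suc)
      define g :: "nat \<Rightarrow> real" where "g i = indicator C ((\<sigma> ^^ i) z)" for i
      have "m (\<sigma> -` C \<inter> Z) = (\<Sum>i<Suc n. g (Suc i)) / real (Suc n)"
        unfolding m_def g_def using orb by (simp add: indicator_def del: sum.lessThan_Suc)
      moreover have "m C = (\<Sum>i<Suc n. g i) / real (Suc n)" unfolding m_def g_def by simp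
      ultimately have "m (\<sigma> -` C \<inter> Z) - m C = (\<Sum>i<Suc n. g (Suc i) - g i) / real (Suc n)"
        by (simp add: sum_subtractf diff_divide_distrib del: sum.lessThan_Suc)
      also have "\<dots> = (g (Suc n) - g 0) / real (Suc n)"
        by (simp only: sum_lessThan_telescope)
      finally have *: "m (\<sigma> -` C \<inter> Z) - m C = (g (Suc n) - g 0) / real (Suc n)" .
      have "\<bar>g (Suc n) - g 0\<bar> \<le> 1" by (simp add: g_def indicator_def)
      then show "\<bar>m (\<sigma> -` C \<inter> Z) - m C\<bar> \<le> 1 / real (Suc n)"
        unfolding * by (simp add: divide_right_mono)
    next
      have "(\<Sum>i<Suc n. indicator Z ((\<sigma> ^^ i) z)) = (\<Sum>i<Suc n. 1::real)"
        using orb by (intro sum.cong) auto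
      then show "m Z = 1" unfolding m_def by (simp del: sum.lessThan_Suc)
    next
      fix B C :: "'a set" assume "B \<inter> C = {}"
      then have "(\<Sum>i<Suc n. indicator (B \<union> C) ((\<sigma> ^^ i) z)) =
        (\<Sum>i<Suc n. indicator B ((\<sigma> ^^ i) z) + (indicator C ((\<sigma> ^^ i) z) :: real))"
        by (intro sum.cong) (auto simp: indicator_def)
      then show "m (B \<union> C) = m B + m C"
        by (simp add: m_def sum.distrib add_divide_distrib del: sum.lessThan_Suc)
    qed
    then show ?thesis by auto
  qed
  have "(\<Inter>n. S n) \<noteq> {}"
  proof (rule Inter_decseq_closed_nonempty)
    show "compact (S 0)" unfolding S_def
      by (intro compact_closed_unit_functions closed_approx_invariant_means)
        (auto simp: approx_invariant_means_def)
    show "decseq S"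
    proof (rule decseq_SucI)
      fix n
      have "1 / real (Suc (Suc n)) \<le> 1 / real (Suc n)" by (simp add: divide_simps)
      then show "S (Suc n) \<subseteq> S n"
        unfolding S_def approx_invariant_means_def by (blast intro: order_trans)
    qed
    show "closed (S n)" for n by (simp add: S_def closed_approx_invariant_means)
  qed (rule ne)
  then obtain m where m: "m \<in> S n" for n by auto
  have "\<bar>m (\<sigma> -` C \<inter> Z) - m C\<bar> \<le> 0" if "C \<in> \<C>" for C
  proof (rule field_le_epsilon)
    fix e :: real assume "0 < e"
    then obtain n where "1 / real (Suc n) < e" using nat_approx_posE by metis
    then show "\<bar>m (\<sigma> -` C \<inter> Z) - m C\<bar> \<le> 0 + e"
      using m[of n] that unfolding S_def approx_invariant_means_def by fastforce
  qed
  then have "m \<in> approx_invariant_means Z \<C> \<sigma> 0"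
    using m[of 0] unfolding S_def approx_invariant_means_def by blast
  then show ?thesis by auto
qed

text \<open>The extreme point is obtained by maximising the coordinates in the countable family lexicographically.\<close>

lemma extreme_point_of_closed_set_of_unit_functions:
  fixes K :: "('b \<Rightarrow> real) set"
  assumes "countable \<C>" "\<C> \<noteq> {}" "closed K" "K \<noteq> {}" "K \<subseteq> {m. \<forall>C. 0 \<le> m C \<and> m C \<le> 1}"
  obtains m where "m \<in> K"
    "\<And>m1 m2 p C. m1 \<in> K \<Longrightarrow> m2 \<in> K \<Longrightarrow> 0 < p \<Longrightarrow> p < 1 \<Longrightarrow>
       (\<And>C. C \<in> \<C> \<Longrightarrow> m C = p * m1 C + (1 - p) * m2 C) \<Longrightarrow> C \<in> \<C> \<Longrightarrow> m1 C = m C"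
proof -
  define c where "c = from_nat_into \<C>"
  \<comment> \<open>Stage n + 1 keeps the maximisers of the n-th coordinate within stage n.\<close>
  define S where "S = rec_nat K (\<lambda>n T. {m \<in> T. \<forall>m'\<in>T. m' (c n) \<le> m (c n)})"
  have S0: "S 0 = K" and SS: "S (Suc n) = {m \<in> S n. \<forall>m'\<in>S n. m' (c n) \<le> m (c n)}" for n
    by (simp_all add: S_def)
  have dec: "decseq S" by (rule decseq_SucI) (auto simp: SS)
  have cl: "closed (S n)" for n
  proof (induction n)
    case (Suc n)
    have "S (Suc n) = S n \<inter> (\<Inter>m'\<in>S n. {m. m' (c n) \<le> m (c n)})" by (auto simp: SS)
    then show ?case using Suc
      by (auto intro!: closed_INT closed_Collect_le continuous_intros continuous_on_product_coordinates)
  qed (simp add: S0 assms)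
  have cp: "compact (S n)" for n
    by (rule compact_closed_unit_functions[OF cl])
      (rule order_trans[OF decseqD[OF dec le0, unfolded S0] assms(5)])
  have ne: "S n \<noteq> {}" for n
  proof (induction n)
    case (Suc n)
    have "continuous_on (S n) (\<lambda>m. m (c n))"
      by (rule continuous_on_subset[OF continuous_on_product_coordinates]) simp
    from continuous_attains_sup[OF cp Suc this]
    obtain m where "m \<in> S n" "\<forall>m'\<in>S n. m' (c n) \<le> m (c n)" by (elim bexE)
    then show ?case by (auto simp: SS)
  qed (simp add: S0 assms)
  have "(\<Inter>n. S n) \<noteq> {}" by (intro Inter_decseq_closed_nonempty cp cl ne dec)
  then obtain m where m: "m \<in> S n" for n by auto
  show ?thesis
  proof
    show "m \<in> K" using m[of 0] S0 by simp
    fix m1 m2 p C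
    assume m12: "m1 \<in> K" "m2 \<in> K" and p: "0 < p" "p < 1" and C: "C \<in> \<C>"
      and comb: "\<And>C. C \<in> \<C> \<Longrightarrow> m C = p * m1 C + (1 - p) * m2 C"
    \<comment> \<open>A convex combination with positive weights equals the maximum only if both
      terms do, so m1 and m2 survive to the next stage.\<close>
    have eq: "m1 (c n) = m (c n) \<and> m2 (c n) = m (c n)" if "m1 \<in> S n" "m2 \<in> S n" for n
    proof -
      have le: "m1 (c n) \<le> m (c n)" "m2 (c n) \<le> m (c n)" using m[of "Suc n"] that by (auto simp: SS)
      have "c n \<in> \<C>" using assms(2) by (simp add: c_def from_nat_into)
      from comb[OF this] have *: "p * (m (c n) - m1 (c n)) + (1 - p) * (m (c n) - m2 (c n)) = 0"
        by (simp add: algebra_simps)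
      have "p * (m (c n) - m1 (c n)) \<ge> 0" "(1 - p) * (m (c n) - m2 (c n)) \<ge> 0" using le p by auto
      then have "p * (m (c n) - m1 (c n)) = 0" "(1 - p) * (m (c n) - m2 (c n)) = 0" using * by linarith+
      then show ?thesis using p by auto
    qed
    have "m1 \<in> S n \<and> m2 \<in> S n" for n
    proof (induction n)
      case (Suc n)
      then show ?case using eq[of n] m[of "Suc n"] by (auto simp: SS)
    qed (use m12 S0 in auto)
    moreover obtain n where "C = c n"
      using C assms by (metis c_def from_nat_into_surj)
    ultimately show "m1 C = m C" using eq by auto
  qed
qed

text \<open>Closed members of the algebra are compact, so countable additivity of a mean is automatic and
  extremality among the invariant means yields ergodicity.\<close>

lemma ergodic_measure_on_clopen_algebra:
  fixes \<sigma> :: "'z::topological_space \<Rightarrow> 'z"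
  assumes alg: "algebra Z \<C>" and cnt: "countable \<C>" and Z: "compact Z" "Z \<noteq> {}"
    and cl: "\<And>C. C \<in> \<C> \<Longrightarrow> closed C"
    and \<sigma>: "\<sigma> \<in> Z \<rightarrow> Z" and \<sigma>\<C>: "\<And>C. C \<in> \<C> \<Longrightarrow> \<sigma> -` C \<inter> Z \<in> \<C>"
  obtains \<nu> where "prob_space \<nu>" "space \<nu> = Z" "sets \<nu> = sigma_sets Z \<C>"
    "\<sigma> \<in> measurable \<nu> \<nu>" "distr \<nu> \<nu> \<sigma> = \<nu>"
    "\<And>D. D \<in> sets \<nu> \<Longrightarrow> \<sigma> -` D \<inter> Z = D \<Longrightarrow> measure \<nu> D = 0 \<or> measure \<nu> D = 1"
proof -
  interpret algebra Z \<C> by fact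
  let ?K = "approx_invariant_means Z \<C> \<sigma> 0"
  have "\<C> \<noteq> {}" using top by auto
  obtain m where m: "m \<in> ?K"
    and ext: "\<And>m1 m2 p C. m1 \<in> ?K \<Longrightarrow> m2 \<in> ?K \<Longrightarrow> 0 < p \<Longrightarrow> p < 1 \<Longrightarrow>
       (\<And>C. C \<in> \<C> \<Longrightarrow> m C = p * m1 C + (1 - p) * m2 C) \<Longrightarrow> C \<in> \<C> \<Longrightarrow> m1 C = m C"
    by (rule extreme_point_of_closed_set_of_unit_functions[OF cnt \<open>\<C> \<noteq> {}\<close> closed_approx_invariant_means
          invariant_mean_exists[OF \<sigma> \<open>Z \<noteq> {}\<close>]])
       (auto simp: approx_invariant_means_def)
  have m01: "0 \<le> m C" "m C \<le> 1" and mZ: "m Z = 1" 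
    and madd: "B \<in> \<C> \<Longrightarrow> C \<in> \<C> \<Longrightarrow> B \<inter> C = {} \<Longrightarrow> m (B \<union> C) = m B + m C"
    and minv: "C \<in> \<C> \<Longrightarrow> m (\<sigma> -` C \<inter> Z) = m C" for B C
    using m by (auto simp: approx_invariant_means_def)
  have m0: "m {} = 0" using madd[of "{}" "{}"] by simp
  have "\<exists>\<mu>. (\<forall>s\<in>\<C>. \<mu> s = ennreal (m s)) \<and> measure_space Z (sigma_sets Z \<C>) \<mu>"
  proof (rule caratheodory_empty_continuous)
    show "positive \<C> (\<lambda>s. ennreal (m s))" by (simp add: positive_def m0)
    show "additive \<C> (\<lambda>s. ennreal (m s))"
      by (simp add: additive_def madd m01 ennreal_plus)
    fix A :: "nat \<Rightarrow> 'z set" assume A: "range A \<subseteq> \<C>" "decseq A" "(\<Inter>i. A i) = {}"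
    have "\<exists>n. A n = {}"
    proof (rule ccontr)
      assume "\<nexists>n. A n = {}"
      moreover have "compact (A 0)"
      proof -
        have "A 0 = Z \<inter> A 0" using A sets_into_space by blast
        then show ?thesis using Z A cl by (metis compact_Int_closed rangeI subsetD)
      qed
      ultimately have "(\<Inter>i. A i) \<noteq> {}"
        using A cl by (intro Inter_decseq_closed_nonempty) auto
      then show False using A by simp
    qed
    then obtain n where "A n = {}" by auto
    then have "A k = {}" if "k \<ge> n" for k using decseqD[OF A(2) that] by auto
    then have "eventually (\<lambda>k. ennreal (m (A k)) = 0) sequentially"
      unfolding eventually_sequentially by (metis m0 ennreal_0)
    then show "(\<lambda>i. ennreal (m (A i))) \<longlonglongrightarrow> 0" by (simp add: tendsto_eventually)
  qed auto
  then obtain \<mu> where \<mu>: "\<And>s. s \<in> \<C> \<Longrightarrow> \<mu> s = ennreal (m s)" "measure_space Z (sigma_sets Z \<C>) \<mu>" by auto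
  define \<nu> where "\<nu> = measure_of Z (sigma_sets Z \<C>) \<mu>"
  have sp: "space \<nu> = Z" unfolding \<nu>_def using \<mu>(2)
    by (simp add: measure_space_closed space_measure_of)
  have sub: "sigma_sets Z \<C> \<subseteq> Pow Z" using \<mu>(2) by (rule measure_space_closed)
  have st: "sets \<nu> = sigma_sets Z \<C>"
    unfolding \<nu>_def sets_measure_of[OF sub] by (rule sigma_sets_sigma_sets_eq[OF space_closed])
  have em: "emeasure \<nu> D = \<mu> D" if "D \<in> sigma_sets Z \<C>" for D
    unfolding \<nu>_def using \<mu>(2) that by (intro emeasure_measure_of_sigma) (auto simp: measure_space_def)
  have emC: "emeasure \<nu> C = ennreal (m C)" if "C \<in> \<C>" for C using em \<mu>(1) that by auto
  have prob: "prob_space \<nu>"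
    by (rule prob_spaceI) (simp add: sp emC mZ)
  interpret \<nu>: prob_space \<nu> by (rule prob)
  have msC: "measure \<nu> C = m C" if "C \<in> \<C>" for C using emC[OF that] m01 by (simp add: measure_def)
  have eqI: "M = \<nu>" if "sets M = sets \<nu>" "\<And>C. C \<in> \<C> \<Longrightarrow> emeasure M C = emeasure \<nu> C" for M
  proof (rule measure_eqI_generator_eq[of \<C> Z _ _ "\<lambda>_. Z"])
    show "Int_stable \<C>" by (auto simp: Int_stable_def)
    show "emeasure M Z \<noteq> \<infinity>" using that(2)[of Z] emC[of Z] by simp
  qed (use that st space_closed in auto)
  have meas: "\<sigma> \<in> measurable \<nu> \<nu>"
  proof (rule measurable_sigma_sets[of _ Z \<C>])
    show "\<sigma> \<in> space \<nu> \<rightarrow> Z" using \<sigma> sp by simp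
    show "\<sigma> -` C \<inter> space \<nu> \<in> sets \<nu>" if "C \<in> \<C>" for C
      using \<sigma>\<C>[OF that] by (simp add: sp st)
  qed (use st space_closed in auto)
  have inv: "distr \<nu> \<nu> \<sigma> = \<nu>"
  proof (rule eqI)
    fix C assume "C \<in> \<C>"
    then show "emeasure (distr \<nu> \<nu> \<sigma>) C = emeasure \<nu> C"
      using meas st minv \<sigma>\<C> by (subst emeasure_distr) (auto simp: sp emC)
  qed simp
  have "measure \<nu> D = 0 \<or> measure \<nu> D = 1" if D: "D \<in> sets \<nu>" "\<sigma> -` D \<inter> Z = D" for D
  proof (rule ccontr)
    assume *: "\<not> ?thesis"
    define p where "p = measure \<nu> D"
    have p: "0 < p" "p < 1" using * \<nu>.prob_le_1[of D] measure_nonneg[of \<nu> D]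
      by (auto simp: p_def less_le simp del: measure_nonneg \<nu>.prob_le_1)
    have Csets: "C \<in> sets \<nu>" if "C \<in> \<C>" for C using that st by auto
    \<comment> \<open>Conditioning on an invariant set of positive measure gives a mean in
      \<open>?K\<close> again, and m is the mixture of the means for D and its complement with
      weights p and 1 - p. Extremality will make conditioning on D change nothing.\<close>
    define cond where "cond E q C = (if C \<in> \<C> then measure \<nu> (C \<inter> E) / q else 0)" for E q C
    have condK: "cond E q \<in> ?K" if E: "E \<in> sets \<nu>" "\<sigma> -` E \<inter> Z = E" and q: "q = measure \<nu> E" "q > 0" for E q
      unfolding approx_invariant_means_def
    proof (intro CollectI conjI allI impI)
      fix C
      have le: "measure \<nu> (C \<inter> E) \<le> q" unfolding q using E(1) by (intro \<nu>.finite_measure_mono) auto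
      show "0 \<le> cond E q C" using q by (simp add: cond_def)
      show "cond E q C \<le> 1" using le q by (auto simp: cond_def)
    next
      have "Z \<inter> E = E" using sets.sets_into_space[OF E(1)] sp by auto
      then show "cond E q Z = 1" using q by (simp add: cond_def)
    next
      fix B C assume BC: "B \<in> \<C>" "C \<in> \<C>" "B \<inter> C = {}"
      have "measure \<nu> ((B \<union> C) \<inter> E) = measure \<nu> (B \<inter> E) + measure \<nu> (C \<inter> E)"
        unfolding Int_Un_distrib2 using BC E(1) Csets by (intro \<nu>.finite_measure_Union) auto
      moreover have "B \<union> C \<in> \<C>" using BC by auto
      ultimately show "cond E q (B \<union> C) = cond E q B + cond E q C"
        using BC by (simp add: cond_def add_divide_distrib)
    next
      fix C assume C: "C \<in> \<C>"
      have "\<sigma> -` (C \<inter> E) \<inter> Z = (\<sigma> -` C \<inter> Z) \<inter> E" using E(2) by blast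
      moreover have "measure \<nu> (C \<inter> E) = measure (distr \<nu> \<nu> \<sigma>) (C \<inter> E)" by (simp add: inv)
      moreover have "\<dots> = measure \<nu> (\<sigma> -` (C \<inter> E) \<inter> Z)"
        using meas Csets[OF C] E(1) by (subst measure_distr) (auto simp: sp)
      ultimately show "\<bar>cond E q (\<sigma> -` C \<inter> Z) - cond E q C\<bar> \<le> 0"
        using C \<sigma>\<C>[OF C] by (simp add: cond_def)
    qed
    have DZ: "D \<subseteq> Z" using sets.sets_into_space[OF D(1)] sp by simp
    have "cond D p \<in> ?K" by (rule condK) (use D(1) p in \<open>simp_all add: p_def D(2)\<close>)
    moreover have "cond (Z - D) (1 - p) \<in> ?K"
    proof (rule condK)
      show "Z - D \<in> sets \<nu>" using D(1) sp by (metis sets.compl_sets)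
      show "\<sigma> -` (Z - D) \<inter> Z = Z - D" using D(2) \<sigma> by blast
      show "1 - p = measure \<nu> (Z - D)" using \<nu>.prob_compl[OF D(1)] sp by (simp add: p_def)
    qed (use p in auto)
    moreover have "m C = p * cond D p C + (1 - p) * cond (Z - D) (1 - p) C" if C: "C \<in> \<C>" for C
    proof -
      have "C = (C \<inter> D) \<union> (C \<inter> (Z - D))" using sets_into_space[OF C] by auto
      then have "measure \<nu> C = measure \<nu> ((C \<inter> D) \<union> (C \<inter> (Z - D)))" by simp
      also have "\<dots> = measure \<nu> (C \<inter> D) + measure \<nu> (C \<inter> (Z - D))"
        using Csets[OF C] D(1) sets.compl_sets[OF D(1)] by (intro \<nu>.finite_measure_Union) (auto simp: sp)
      finally show ?thesis using p C by (simp add: cond_def msC)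
    qed
    ultimately have "cond D p C = m C" if "C \<in> \<C>" for C
      using ext[of "cond D p" "cond (Z - D) (1 - p)" p C] p that by blast
    then have mCD: "measure \<nu> (C \<inter> D) / p = m C" if "C \<in> \<C>" for C using that by (simp add: cond_def)
    have "emeasure \<nu> D \<noteq> 0" using p by (auto simp: p_def measure_def)
    \<comment> \<open>Agreement on the generating algebra extends to all measurable sets, in
      particular to D, which has conditional measure 1.\<close>
    have "uniform_measure \<nu> D = \<nu>"
    proof (rule eqI)
      fix C assume C: "C \<in> \<C>"
      have "emeasure (uniform_measure \<nu> D) C = emeasure \<nu> (D \<inter> C) / emeasure \<nu> D"
        using D(1) Csets[OF C] by simp
      also have "\<dots> = ennreal (measure \<nu> (C \<inter> D) / p)"
        unfolding \<nu>.emeasure_eq_measure p_def Int_commute[of D]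
        by (rule divide_ennreal) (use p in \<open>simp_all only: p_def measure_nonneg\<close>)
      finally show "emeasure (uniform_measure \<nu> D) C = emeasure \<nu> C"
        using C by (simp add: mCD emC)
    qed simp
    moreover have "emeasure (uniform_measure \<nu> D) D = 1"
      using \<open>emeasure \<nu> D \<noteq> 0\<close> by (intro emeasure_uniform_measure_1) auto
    ultimately have "emeasure \<nu> D = 1" by simp
    then show False using p by (simp add: p_def measure_def)
  qed
  then show thesis using that prob sp st meas inv by blast
qed

text \<open>The orbit of a point is coded by an array of points z i k, chosen in a finite set, approximating the i-th
  iterate up to the k-th power of 1/2. The space of codes is compact with a clopen basis, the shift on it
  factors onto f, and an ergodic measure of the shift is pushed forward. Existence matters
  for the main theorem because Inf and Sup of the empty set are unspecified reals.\<close>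

lemma ergodic_measure_exists:
  fixes f :: "'a::metric_space \<Rightarrow> 'a"
  assumes comp: "compact (UNIV :: 'a set)" and f: "continuous_on UNIV f"
  shows "\<exists>\<mu>. ergodic_measure f \<mu>"
proof -
  have "\<exists>F. finite F \<and> (\<forall>x::'a. \<exists>q\<in>F. dist x q \<le> (1/2)^k)" for k :: nat
  proof -
    obtain F where "finite F" "(UNIV :: 'a set) \<subseteq> (\<Union>x\<in>F. ball x ((1/2)^k))"
      using seq_compact_imp_totally_bounded[of "UNIV :: 'a set"] comp
      by (metis compact_imp_seq_compact half_gt_zero_iff zero_less_one zero_less_power)
    then show ?thesis
      by (intro exI[of _ F]) (auto simp: subset_iff dist_commute intro: less_imp_le)
  qed
  then obtain F :: "nat \<Rightarrow> 'a set" where F: "\<And>k. finite (F k)" "\<And>k x. \<exists>q\<in>F k. dist x q \<le> (1/2)^k"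
    by metis
  \<comment> \<open>The non-strict bound makes coding a closed relation, at the price of several
    codes for one point.\<close>
  define code where "code x z \<longleftrightarrow> (\<forall>i k. z i k \<in> F k \<and> dist ((f ^^ i) x) (z i k) \<le> (1/2)^k)"
    for x and z :: "nat \<Rightarrow> nat \<Rightarrow> 'a"
  define Z where "Z = {z. \<exists>x. code x z}"
  define \<sigma> where "\<sigma> z = (\<lambda>i. z (Suc i))" for z :: "nat \<Rightarrow> nat \<Rightarrow> 'a"
  have fi: "continuous_on UNIV (f ^^ i)" for i
    by (rule continuous_on_funpow[OF f])
  have cpt: "compact (PiE UNIV S)" if "\<And>i. compact (S i)" for S :: "nat \<Rightarrow> 'b::topological_space set"
  proof -
    have "compactin (product_topology (\<lambda>_. euclidean) UNIV) (PiE UNIV S)"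
      using that by (simp add: compactin_PiE)
    then show ?thesis by (simp add: euclidean_product_topology)
  qed
  have "compact Z"
  proof -
    define W where "W = {p. code (fst p) (snd p)}"
    have "W = (UNIV \<times> PiE UNIV (\<lambda>i. PiE UNIV F)) \<inter>
      (\<Inter>i. \<Inter>k. {p. dist ((f ^^ i) (fst p)) (snd p i k) \<le> (1/2)^k})"
      by (auto simp: W_def code_def PiE_UNIV_domain Pi_iff)
    moreover have "closed {p :: 'a \<times> (nat \<Rightarrow> nat \<Rightarrow> 'a). dist ((f ^^ i) (fst p)) (snd p i k) \<le> (1/2)^k}" for i k
    proof (intro closed_Collect_le continuous_on_dist continuous_on_const)
      show "continuous_on UNIV (\<lambda>p :: 'a \<times> (nat \<Rightarrow> nat \<Rightarrow> 'a). (f ^^ i) (fst p))"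
        by (rule continuous_on_compose2[OF fi continuous_on_fst[OF continuous_on_id]]) simp
      have "continuous_on UNIV (\<lambda>p :: 'a \<times> (nat \<Rightarrow> nat \<Rightarrow> 'a). snd p i)"
        by (rule continuous_on_product_then_coordinatewise[OF continuous_on_snd[OF continuous_on_id]])
      then show "continuous_on UNIV (\<lambda>p :: 'a \<times> (nat \<Rightarrow> nat \<Rightarrow> 'a). snd p i k)"
        by (rule continuous_on_product_then_coordinatewise)
    qed
    moreover have "compact ((UNIV :: 'a set) \<times> PiE UNIV (\<lambda>i::nat. PiE UNIV F))"
      by (rule compact_Times[OF comp], rule cpt, rule cpt, rule finite_imp_compact, rule F(1))
    ultimately have "compact W" by (auto intro!: compact_Int_closed closed_INT)
    moreover have "Z = snd ` W" by (auto simp: Z_def W_def image_iff)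
    ultimately show ?thesis by (simp only:) (intro compact_continuous_image continuous_on_snd continuous_on_id)
  qed
  \<comment> \<open>The window of the first n rows and columns takes finitely many values on Z, so
    the sets determined by windows form a countable algebra of clopen subsets of Z.\<close>
  define r where "r n z = restrict (\<lambda>i. restrict (z i) {..<n}) {..<n}" for n :: nat and z :: "nat \<Rightarrow> nat \<Rightarrow> 'a"
  define \<C> where "\<C> = {C. \<exists>n P. C = {z \<in> Z. r n z \<in> P}}"
  have \<C>I: "{z \<in> Z. r n z \<in> P} \<in> \<C>" for n P unfolding \<C>_def by blast
  have rr: "r n (r m z) = r n z" if "n \<le> m" for n m z
    using that by (auto simp: r_def fun_eq_iff)
  have r\<sigma>: "r n (\<sigma> (r (Suc n) z)) = r n (\<sigma> z)" for n z
    by (auto simp: r_def \<sigma>_def fun_eq_iff)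
  have fin: "finite (r n ` Z)" for n
  proof (rule finite_subset)
    show "r n ` Z \<subseteq> PiE {..<n} (\<lambda>_. PiE {..<n} F)"
      by (auto simp: r_def Z_def code_def restrict_def PiE_iff extensional_def split: if_splits)
    show "finite (PiE {..<n} (\<lambda>_. PiE {..<n} F))"
      using F by (intro finite_PiE) auto
  qed
  have "algebra Z \<C>"
  proof (subst algebra_iff_Un, intro conjI ballI)
    show "\<C> \<subseteq> Pow Z" by (auto simp: \<C>_def)
    show "{} \<in> \<C>" using \<C>I[of 0 "{}"] by simp
    show "Z - C \<in> \<C>" if "C \<in> \<C>" for C
    proof -
      obtain n P where "C = {z \<in> Z. r n z \<in> P}" using \<open>C \<in> \<C>\<close> unfolding \<C>_def by blast
      then have "Z - C = {z \<in> Z. r n z \<in> - P}" by auto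
      then show ?thesis by (simp only: \<C>I)
    qed
    show "B \<union> C \<in> \<C>" if "B \<in> \<C>" "C \<in> \<C>" for B C
    proof -
      obtain n P m Q where *: "B = {z \<in> Z. r n z \<in> P}" "C = {z \<in> Z. r m z \<in> Q}"
        using \<open>B \<in> \<C>\<close> \<open>C \<in> \<C>\<close> unfolding \<C>_def by blast
      have "B \<union> C = {z \<in> Z. r (max n m) z \<in> {w. r n w \<in> P \<or> r m w \<in> Q}}"
        by (auto simp: * rr)
      then show ?thesis by (simp only: \<C>I)
    qed
  qed
  have "countable \<C>"
  proof (rule countable_subset)
    show "\<C> \<subseteq> (\<Union>n. (\<lambda>P. {z \<in> Z. r n z \<in> P}) ` Pow (r n ` Z))"
    proof
      fix C assume "C \<in> \<C>"
      then obtain n P where "C = {z \<in> Z. r n z \<in> P}" unfolding \<C>_def by blast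
      then have "C = {z \<in> Z. r n z \<in> P \<inter> r n ` Z}" by auto
      then show "C \<in> (\<Union>n. (\<lambda>P. {z \<in> Z. r n z \<in> P}) ` Pow (r n ` Z))" by blast
    qed
    show "countable (\<Union>n. (\<lambda>P. {z \<in> Z. r n z \<in> P}) ` Pow (r n ` Z))"
      using fin by (intro countable_UN countable_image) (auto intro: countable_finite)
  qed
  have "closed Z" using \<open>compact Z\<close> by (rule compact_imp_closed)
  have clC: "closed C" if "C \<in> \<C>" for C
  proof -
    obtain n P where C: "C = {z \<in> Z. r n z \<in> P}" using \<open>C \<in> \<C>\<close> unfolding \<C>_def by blast
    have "C = (\<Union>p\<in>P \<inter> r n ` Z. Z \<inter> {z. r n z = p})" unfolding C by auto
    moreover have "closed (Z \<inter> {z. r n z = p})" if "p \<in> r n ` Z" for p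
    proof -
      obtain z0 where "p = r n z0" using \<open>p \<in> r n ` Z\<close> by auto
      then have "{z. r n z = p} = (\<Inter>i\<in>{..<n}. \<Inter>k\<in>{..<n}. {z. z i k = z0 i k})"
        by (auto simp: r_def fun_eq_iff restrict_def)
      moreover have "closed {z :: nat \<Rightarrow> nat \<Rightarrow> 'a. z i k = z0 i k}" for i k
        by (rule closed_Collect_eq[OF _ continuous_on_const],
            rule continuous_on_product_then_coordinatewise[OF continuous_on_product_then_coordinatewise[OF continuous_on_id]])
      ultimately show ?thesis using \<open>closed Z\<close> by (auto intro!: closed_Int closed_INT)
    qed
    then have "closed (\<Union>p\<in>P \<inter> r n ` Z. Z \<inter> {z. r n z = p})"
      using fin[of n] by (intro closed_UN) auto
    ultimately show ?thesis by simp
  qed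
  have code\<sigma>: "code (f x) (\<sigma> z)" if "code x z" for x z
    unfolding code_def
  proof (intro allI)
    fix i k
    show "\<sigma> z i k \<in> F k \<and> dist ((f ^^ i) (f x)) (\<sigma> z i k) \<le> (1/2)^k"
      using that[unfolded code_def, rule_format, of "Suc i" k] by (simp add: \<sigma>_def funpow_swap1)
  qed
  have \<sigma>Z: "\<sigma> \<in> Z \<rightarrow> Z" using code\<sigma> by (auto simp: Z_def)
  have \<sigma>C: "\<sigma> -` C \<inter> Z \<in> \<C>" if "C \<in> \<C>" for C
  proof -
    obtain n P where "C = {z \<in> Z. r n z \<in> P}" using \<open>C \<in> \<C>\<close> unfolding \<C>_def by blast
    then have "\<sigma> -` C \<inter> Z = {z \<in> Z. r (Suc n) z \<in> {w. r n (\<sigma> w) \<in> P}}"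
      using \<sigma>Z by (auto simp: r\<sigma>)
    then show ?thesis by (simp only: \<C>I)
  qed
  have "Z \<noteq> {}"
  proof -
    obtain q where "\<And>k x. q k x \<in> F k \<and> dist x (q k x) \<le> (1/2)^k" using F(2) by metis
    then have "code x (\<lambda>i k. q k ((f ^^ i) x))" for x by (simp add: code_def)
    then show ?thesis by (auto simp: Z_def)
  qed
  obtain \<nu> where \<nu>: "prob_space \<nu>" "space \<nu> = Z" "sets \<nu> = sigma_sets Z \<C>"
    "\<sigma> \<in> measurable \<nu> \<nu>" "distr \<nu> \<nu> \<sigma> = \<nu>"
    and erg: "\<And>D. D \<in> sets \<nu> \<Longrightarrow> \<sigma> -` D \<inter> Z = D \<Longrightarrow> measure \<nu> D = 0 \<or> measure \<nu> D = 1"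
    by (rule ergodic_measure_on_clopen_algebra[OF \<open>algebra Z \<C>\<close> \<open>countable \<C>\<close> \<open>compact Z\<close> \<open>Z \<noteq> {}\<close>
          clC \<sigma>Z \<sigma>C]) blast+
  interpret \<nu>: prob_space \<nu> by fact
  \<comment> \<open>On Z the choice is unambiguous, since row 0 of a code converges to the coded
    point.\<close>
  define \<pi> where "\<pi> z = (SOME x. code x z)" for z
  have \<pi>: "code (\<pi> z) z" if "z \<in> Z" for z
    using that unfolding \<pi>_def Z_def by (auto intro: someI_ex)
  have lim: "(\<lambda>k. z 0 k) \<longlonglongrightarrow> x" if "code x z" for x z
  proof (rule metric_LIMSEQ_I)
    fix e :: real assume "0 < e"
    then obtain K where "(1/2)^K < e" using real_arch_pow_inv[of e "1/2"] by auto
    moreover have "dist (z 0 k) x \<le> (1/2)^K" if "k \<ge> K" for k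
    proof -
      have "dist x (z 0 k) \<le> (1/2)^k"
        using \<open>code x z\<close>[unfolded code_def, rule_format, of 0 k] by simp
      also have "\<dots> \<le> (1/2)^K" using that by (intro power_decreasing) auto
      finally show ?thesis by (simp add: dist_commute)
    qed
    ultimately show "\<exists>no. \<forall>n\<ge>no. dist (z 0 n) x < e" by (meson le_less_trans)
  qed
  have uniq: "x = y" if "code x z" "code y z" for x y z
    using lim[OF that(1)] lim[OF that(2)] by (rule LIMSEQ_unique)
  have \<pi>\<sigma>: "\<pi> (\<sigma> z) = f (\<pi> z)" if "z \<in> Z" for z
    using \<sigma>Z that by (intro uniq[OF \<pi> code\<sigma>[OF \<pi>]]) auto
  have [measurable]: "\<pi> \<in> borel_measurable \<nu>"
  \<comment> \<open>The preimage of any set whatsoever under a single entry is a member of \<C>, so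
    the entries are measurable and \<pi> is their pointwise limit.\<close>
  proof (rule borel_measurable_LIMSEQ_metric)
    show "(\<lambda>z. z 0 k) \<in> borel_measurable \<nu>" for k
    proof (rule measurableI)
      fix U :: "'a set"
      have "(\<lambda>z. z 0 k) -` U \<inter> Z = {z \<in> Z. r (Suc k) z \<in> {w. w 0 k \<in> U}}"
        by (auto simp: r_def)
      then show "(\<lambda>z. z 0 k) -` U \<inter> space \<nu> \<in> sets \<nu>"
        unfolding \<nu>(2,3) by (simp only: \<C>I sigma_sets.Basic)
    qed simp
    show "(\<lambda>k. z 0 k) \<longlonglongrightarrow> \<pi> z" if "z \<in> space \<nu>" for z
      using that \<nu>(2) \<pi> lim by auto
  qed
  have [measurable]: "f \<in> borel_measurable borel" using f by (rule borel_measurable_continuous_onI)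
  define \<mu> where "\<mu> = distr \<nu> borel \<pi>"
  have sets\<mu>: "sets \<mu> = sets borel" by (simp add: \<mu>_def)
  have "distr \<mu> \<mu> f = distr \<mu> borel f" using sets\<mu> by (intro distr_cong) auto
  also have "\<dots> = distr \<nu> borel (f \<circ> \<pi>)" unfolding \<mu>_def by (rule distr_distr) measurable
  also have "\<dots> = distr \<nu> borel (\<pi> \<circ> \<sigma>)" using \<pi>\<sigma> \<nu>(2) by (intro distr_cong) auto
  also have "\<dots> = distr (distr \<nu> \<nu> \<sigma>) borel \<pi>" using \<nu>(4) by (intro distr_distr[symmetric]) measurable
  also have "\<dots> = \<mu>" by (simp add: \<nu>(5) \<mu>_def)
  finally have inv: "distr \<mu> \<mu> f = \<mu>" .
  have "measure \<mu> B = 0 \<or> measure \<mu> B = 1" if B: "B \<in> sets \<mu>" "f -` B = B" for B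
  proof -
    have [measurable]: "B \<in> sets borel" using B(1) sets\<mu> by simp
    have "measure \<mu> B = measure \<nu> (\<pi> -` B \<inter> Z)"
      unfolding \<mu>_def by (subst measure_distr) (auto simp: \<nu>(2))
    moreover have "\<sigma> -` (\<pi> -` B \<inter> Z) \<inter> Z = \<pi> -` B \<inter> Z"
    proof (rule set_eqI)
      fix z
      have "f (\<pi> z) \<in> B \<longleftrightarrow> \<pi> z \<in> B" using B(2) by blast
      then show "z \<in> \<sigma> -` (\<pi> -` B \<inter> Z) \<inter> Z \<longleftrightarrow> z \<in> \<pi> -` B \<inter> Z"
        using \<pi>\<sigma>[of z] \<sigma>Z by auto
    qed
    moreover have "\<pi> -` B \<inter> Z \<in> sets \<nu>" unfolding \<nu>(2)[symmetric] by measurable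
    ultimately show ?thesis using erg by simp
  qed
  moreover have "prob_space \<mu>" unfolding \<mu>_def by (rule \<nu>.prob_space_distr) measurable
  moreover have "f \<in> measurable \<mu> \<mu>" using sets\<mu> by (simp add: measurable_def sets_eq_imp_space_eq[OF sets\<mu>] 
      \<open>f \<in> borel_measurable borel\<close>[unfolded measurable_def, simplified])
  ultimately have "ergodic_measure f \<mu>"
    using inv sets\<mu> by (auto simp: ergodic_measure_def invariant_measure_def)
  then show ?thesis by blast
qed

section \<open>Shadowing and separated orbits\<close>

definition spec_gap :: "('a::metric_space \<Rightarrow> 'a) \<Rightarrow> real \<Rightarrow> real \<Rightarrow> nat \<Rightarrow> bool" where
  "spec_gap f lam \<delta> N \<longleftrightarrow> N > 0 \<and>
     (\<forall>k::nat. \<forall>xs::nat \<Rightarrow> 'a. \<forall>Ns Ms :: nat \<Rightarrow> nat.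
        k \<ge> 1 \<longrightarrow> Ns 1 = 0 \<longrightarrow>
        (\<forall>j. 2 \<le> j \<and> j \<le> k \<longrightarrow> Ns j \<ge> Ns (j - 1) + Ms (j - 1) + N) \<longrightarrow>
        (\<Inter>i\<in>{1..k}. (f ^^ Ns i) -` bowen_ball f (xs i) \<delta> lam (Ms i)) \<noteq> {})"

lemma exp_specification_iff_spec_gap:
  "exp_specification f \<longleftrightarrow> (\<exists>lam>0. \<forall>\<delta>>0. \<exists>N. spec_gap f lam \<delta> N)"
  by (simp add: exp_specification_def spec_gap_def)

text \<open>Blocks are numbered from 0 for the recursions below, and the inequalities are weakened
  to the non-strict form that survives limits.\<close>

lemma spec_gap_finite:
  assumes "spec_gap f lam \<delta> N" "Ns 0 = 0" "\<And>j. Suc j < k \<Longrightarrow> Ns j + Ms j + N \<le> Ns (Suc j)" "k > 0"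
  shows "\<exists>y. \<forall>j<k. \<forall>i\<le>Ms j. dist ((f ^^ i) (xs j)) ((f ^^ (Ns j + i)) y)
    \<le> \<delta> * exp (- lam * real (min i (Ms j - i)))"
proof -
  have "(\<Inter>i\<in>{1..k}. (f ^^ Ns (i - 1)) -` bowen_ball f (xs (i - 1)) \<delta> lam (Ms (i - 1))) \<noteq> {}"
  proof (rule assms(1)[unfolded spec_gap_def, THEN conjunct2, rule_format])
    fix j assume "2 \<le> j \<and> j \<le> k"
    then show "Ns (j - 1 - 1) + Ms (j - 1 - 1) + N \<le> Ns (j - 1)"
      using assms(3)[of "j - 2"] by (cases j rule: nat.exhaust; cases "j - 1") auto
  qed (use assms in auto)
  then obtain y where y: "\<And>i. i \<in> {1..k} \<Longrightarrow> y \<in> (f ^^ Ns (i - 1)) -` bowen_ball f (xs (i - 1)) \<delta> lam (Ms (i - 1))"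
    by blast
  show ?thesis
  proof (intro exI[of _ y] allI impI)
    fix j i assume "j < k" "i \<le> Ms j"
    then show "dist ((f ^^ i) (xs j)) ((f ^^ (Ns j + i)) y) \<le> \<delta> * exp (- lam * real (min i (Ms j - i)))"
      using y[of "Suc j"] unfolding bowen_ball_def
      by (simp add: funpow_add add.commute[of "Ns j"] less_imp_le)
  qed
qed

text \<open>Blocks of length 0 prescribe single visits. Finitely many are realised by specification,
  all of them by a limit of a subsequence.\<close>

lemma spec_gap_visits:
  fixes f :: "'a::metric_space \<Rightarrow> 'a"
  assumes comp: "compact (UNIV :: 'a set)" and f: "continuous_on UNIV f"
    and gap: "spec_gap f lam \<delta> N" and Ns: "Ns 0 = 0" "\<And>j. Ns j + N \<le> Ns (Suc j)"
  shows "\<exists>y. \<forall>j. dist x ((f ^^ Ns j) y) \<le> \<delta>"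
proof -
  have "\<exists>y. \<forall>j<Suc n. dist x ((f ^^ Ns j) y) \<le> \<delta>" for n
    using spec_gap_finite[OF gap, of Ns "Suc n" "\<lambda>_. 0" "\<lambda>_. x"] Ns by simp
  then obtain Y where Y: "\<And>n j. j \<le> n \<Longrightarrow> dist x ((f ^^ Ns j) (Y n)) \<le> \<delta>" 
    unfolding less_Suc_eq_le by metis
  obtain y r where r: "strict_mono r" "(Y \<circ> r) \<longlonglongrightarrow> y"
    using comp[unfolded compact_def, rule_format, of Y] by auto
  have "dist x ((f ^^ Ns j) y) \<le> \<delta>" for j
  proof (rule LIMSEQ_le_const2)
    show "(\<lambda>n. dist x ((f ^^ Ns j) ((Y \<circ> r) n))) \<longlonglongrightarrow> dist x ((f ^^ Ns j) y)"
      by (intro tendsto_dist tendsto_const tendsto_funpow[OF f] r)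
    show "\<exists>K. \<forall>n\<ge>K. dist x ((f ^^ Ns j) ((Y \<circ> r) n)) \<le> \<delta>"
      using Y order_trans[OF _ seq_suble[OF r(1)]] by (auto intro!: exI[of _ j])
  qed
  then show ?thesis by blast
qed

text \<open>One gap serves only one scale, so the orbit is built recursively:
  \<open>Y (Suc k)\<close> follows \<open>Y k\<close> on the whole initial segment up to
  \<open>T k\<close> and then the next block, both at scale \<delta> / 2^(k + 1). The corrections
  sum to a geometric series, and a limit point of the sequence follows every block.\<close>

lemma spec_gap_shadowing:
  fixes f :: "'a::metric_space \<Rightarrow> 'a"
  assumes comp: "compact (UNIV :: 'a set)" and f: "continuous_on UNIV f"
    and lam: "lam > 0" and \<delta>: "\<delta> > 0" and gap: "\<And>k. spec_gap f lam (\<delta> / 2^k) (N k)"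
    and Ns: "Ns 0 = 0" "\<And>k. Ns k + Ms k + N (Suc k) \<le> Ns (Suc k)"
  shows "\<exists>y. \<forall>k. \<forall>i\<le>Ms k. dist ((f ^^ i) (xs k)) ((f ^^ (Ns k + i)) y)
    \<le> (2 * \<delta> / 2^k) * exp (- lam * real (min i (Ms k - i)))"
proof -
  define T where "T k = Ns k + Ms k" for k
  define e where "e i M = exp (- lam * real (min i (M - i)))" for i M :: nat
  define P where "P k y \<longleftrightarrow> (\<forall>i\<le>Ms k. dist ((f ^^ i) (xs k)) ((f ^^ (Ns k + i)) y) \<le> \<delta> / 2^k * e i (Ms k))"
    for k y
  define Q where "Q k x y \<longleftrightarrow> (\<forall>i\<le>T k. dist ((f ^^ i) x) ((f ^^ i) y) \<le> \<delta> / 2^(Suc k) * e i (T k))"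
    for k x y
  have "\<exists>Y. \<forall>n. P n (Y n) \<and> Q n (Y n) (Y (Suc n))"
  proof (rule dependent_nat_choice)
    have "P 0 (xs 0)" using \<delta> by (simp add: P_def e_def Ns)
    then show "\<exists>y. P 0 y" by blast
  next
    fix x k
    define xs' where "xs' j = (if j = 0 then x else xs (Suc k))" for j :: nat
    define Ns' where "Ns' j = (if j = 0 then 0 else Ns (Suc k))" for j :: nat
    define Ms' where "Ms' j = (if j = 0 then T k else Ms (Suc k))" for j :: nat
    obtain y where y: "\<forall>j<2. \<forall>i\<le>Ms' j. dist ((f ^^ i) (xs' j)) ((f ^^ (Ns' j + i)) y)
        \<le> \<delta> / 2^(Suc k) * exp (- lam * real (min i (Ms' j - i)))"
      using spec_gap_finite[OF gap[of "Suc k"], of Ns' 2 Ms' xs'] Ns(2)[of k]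
      by (auto simp: Ns'_def Ms'_def T_def)
    have "Q k x y" using y[rule_format, of 0] by (simp add: Q_def e_def xs'_def Ns'_def Ms'_def)
    moreover have "P (Suc k) y" using y[rule_format, of 1] by (simp add: P_def e_def xs'_def Ns'_def Ms'_def)
    ultimately show "\<exists>y. P (Suc k) y \<and> Q k x y" by blast
  qed
  then obtain Y where YP: "\<And>n. P n (Y n)" and YQ: "\<And>n. Q n (Y n) (Y (Suc n))" by blast
  have Tmono: "T k \<le> T (k + d)" for k d
  proof (induction d)
    case (Suc d)
    then show ?case using Ns(2)[of "k + d"] by (simp add: T_def)
  qed simp
  \<comment> \<open>The factor 2 - 1 / 2^d is the partial sum 1 + 1/2 + ... + 1 / 2^d of the errors
    of stages k to k + d.\<close>
  have bound: "dist ((f ^^ i) (xs k)) ((f ^^ (Ns k + i)) (Y (k + d))) \<le> \<delta> / 2^k * (2 - 1 / 2^d) * e i (Ms k)"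
    if i: "i \<le> Ms k" for i k d
  proof (induction d)
    case 0
    then show ?case using YP[of k] i by (simp add: P_def)
  next
    case (Suc d)
    have le: "Ns k + i \<le> T (k + d)" using Tmono[of k d] i by (simp add: T_def)
    \<comment> \<open>A time inside block k is at least as far from the ends of the long initial
      segment as from the ends of the block, so later corrections inherit the decay of the
      block.\<close>
    have "min i (Ms k - i) \<le> min (Ns k + i) (T (k + d) - (Ns k + i))"
      using Tmono[of k d] i by (auto simp: T_def)
    then have "e (Ns k + i) (T (k + d)) \<le> e i (Ms k)"
      using lam unfolding e_def by (intro exp_le_cancel_iff[THEN iffD2]) simp
    then have "\<delta> / 2^(Suc (k + d)) * e (Ns k + i) (T (k + d)) \<le> \<delta> / 2^(Suc (k + d)) * e i (Ms k)"
      using \<delta> by (intro mult_left_mono) auto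
    then have "dist ((f ^^ (Ns k + i)) (Y (k + d))) ((f ^^ (Ns k + i)) (Y (Suc (k + d)))) \<le> \<delta> / 2^(Suc (k + d)) * e i (Ms k)"
      using YQ[of "k + d"] le unfolding Q_def by (meson order_trans)
    then have "dist ((f ^^ i) (xs k)) ((f ^^ (Ns k + i)) (Y (k + Suc d)))
      \<le> \<delta> / 2^k * (2 - 1 / 2^d) * e i (Ms k) + \<delta> / 2^(Suc (k + d)) * e i (Ms k)"
      using Suc dist_triangle[of "(f ^^ i) (xs k)" "(f ^^ (Ns k + i)) (Y (k + Suc d))" "(f ^^ (Ns k + i)) (Y (k + d))"]
      by simp
    also have "\<dots> = \<delta> / 2^k * (2 - 1 / 2^(Suc d)) * e i (Ms k)"
      by (simp add: power_add field_simps)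
    finally show ?case .
  qed
  obtain y r where r: "strict_mono r" "(Y \<circ> r) \<longlonglongrightarrow> y"
    using comp[unfolded compact_def, rule_format, of Y] by auto
  have "dist ((f ^^ i) (xs k)) ((f ^^ (Ns k + i)) y) \<le> (2 * \<delta> / 2^k) * e i (Ms k)"
    if i: "i \<le> Ms k" for i k
  proof (rule LIMSEQ_le_const2)
    show "(\<lambda>n. dist ((f ^^ i) (xs k)) ((f ^^ (Ns k + i)) ((Y \<circ> r) n)))
        \<longlonglongrightarrow> dist ((f ^^ i) (xs k)) ((f ^^ (Ns k + i)) y)"
      by (intro tendsto_dist tendsto_const tendsto_funpow[OF f] r)
    have "dist ((f ^^ i) (xs k)) ((f ^^ (Ns k + i)) (Y n)) \<le> (2 * \<delta> / 2^k) * e i (Ms k)" if "n \<ge> k" for n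
    proof -
      have "dist ((f ^^ i) (xs k)) ((f ^^ (Ns k + i)) (Y (k + (n - k))))
          \<le> \<delta> / 2^k * (2 - 1 / 2^(n - k)) * e i (Ms k)"
        by (rule bound[OF i])
      also have "\<dots> \<le> \<delta> / 2^k * 2 * e i (Ms k)"
        using \<delta> by (intro mult_right_mono mult_left_mono) (auto simp: e_def)
      finally show ?thesis using that by (simp add: mult.commute)
    qed
    then show "\<exists>K. \<forall>n\<ge>K. dist ((f ^^ i) (xs k)) ((f ^^ (Ns k + i)) ((Y \<circ> r) n)) \<le> (2 * \<delta> / 2^k) * e i (Ms k)"
      using order_trans[OF _ seq_suble[OF r(1)]] by (auto intro!: exI[of _ k])
  qed
  then show ?thesis unfolding e_def by blast
qed

section \<open>Two orbits at positive distance from each other\<close>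

lemma exists_complement_to_multiple:
  fixes L :: nat
  assumes "L > 0"
  shows "\<exists>r<L. \<exists>c. n + r = c * L"
proof (induction n)
  case (Suc n)
  then obtain r c where r: "r < L" "n + r = c * L" by blast
  show ?case
  proof (cases r)
    case 0
    then have "Suc n + (L - 1) = (c + 1) * L" using r assms by simp
    then show ?thesis using assms by (metis diff_less zero_less_one)
  next
    case (Suc s)
    then show ?thesis using r by (intro exI[of _ s]) auto
  qed
qed (use assms in auto)

text \<open>Visiting a small ball around p along a fixed arithmetic progression of step L confines an orbit closure
  to points which, for some phase modulo L, are always close to p; specification also yields a point w that
  is close to q at times in every residue class modulo L, hence w lies outside that closure. An orbit
  returning to w with bounded gaps then stays away from it.\<close>

lemma separated_orbits:
  fixes f :: "'a::metric_space \<Rightarrow> 'a"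
  assumes comp: "compact (UNIV :: 'a set)" and f: "continuous_on UNIV f"
    and gap: "\<And>\<delta>. \<delta> > 0 \<Longrightarrow> \<exists>N. spec_gap f lam \<delta> N" and pq: "p \<noteq> (q :: 'a)"
  obtains u v t where "t > 0" "\<And>i j. t \<le> dist ((f ^^ i) u) ((f ^^ j) v)"
proof -
  \<comment> \<open>A third of the distance, so that no point is within \<delta> of both p and
    q.\<close>
  define \<delta> where "\<delta> = dist p q / 3"
  have "\<delta> > 0" using pq by (simp add: \<delta>_def)
  then obtain L where L: "spec_gap f lam \<delta> L" using gap by blast
  have L0: "L > 0" using L by (simp add: spec_gap_def)
  have fcont: "continuous_on UNIV (\<lambda>z. dist x ((f ^^ n) z))" for x n
    by (intro continuous_on_dist continuous_on_const continuous_on_funpow f)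
  obtain u where u: "\<And>j. dist p ((f ^^ (j * L)) u) \<le> \<delta>"
    using spec_gap_visits[OF comp f L, of "\<lambda>j. j * L" p] by auto
  \<comment> \<open>The step L * L + 1 is 1 modulo L, so the r-th visit takes place at a time
    congruent to r; it also exceeds the gap L.\<close>
  obtain w where w: "\<And>j. dist q ((f ^^ (j * (L * L + 1))) w) \<le> \<delta>"
    using spec_gap_visits[OF comp f L, of "\<lambda>j. j * (L * L + 1)" q] le_square[of L] by auto
  define G where "G = (\<Union>r<L. {z. \<forall>j. dist p ((f ^^ (j * L + r)) z) \<le> \<delta>})"
  have "closed G" unfolding G_def
    by (intro closed_UN ballI closed_Collect_all closed_Collect_le fcont continuous_on_const) simp
  define E where "E = closure (range (\<lambda>n. (f ^^ n) u))"
  have "(f ^^ n) u \<in> G" for n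
  proof -
    obtain r c where "r < L" and c: "n + r = c * L" using exists_complement_to_multiple[OF L0] by blast
    have "dist p ((f ^^ (j * L + r)) ((f ^^ n) u)) \<le> \<delta>" for j
    proof -
      have "(f ^^ (j * L + r)) ((f ^^ n) u) = (f ^^ (j * L + (n + r))) u"
        by (simp add: funpow_add[THEN fun_cong, simplified, symmetric] ac_simps)
      then show ?thesis using u[of "j + c"] c by (simp add: algebra_simps)
    qed
    then show ?thesis using \<open>r < L\<close> by (auto simp: G_def)
  qed
  then have EG: "E \<subseteq> G" unfolding E_def using \<open>closed G\<close> by (intro closure_minimal) auto
  have "w \<notin> G"
  proof
    assume "w \<in> G"
    then obtain r where "\<And>j. dist p ((f ^^ (j * L + r)) w) \<le> \<delta>" by (auto simp: G_def)
    \<comment> \<open>The time (r * L) * L + r of phase r is the time of the r-th visit to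
      q.\<close>
    from this[of "r * L"] w[of r] have "dist p q \<le> \<delta> + \<delta>"
      using dist_triangle_le[of p "(f ^^ (r * (L * L + 1))) w" q] by (simp add: algebra_simps dist_commute)
    then show False using \<open>\<delta> > 0\<close> by (simp add: \<delta>_def)
  qed
  then obtain \<delta>' where \<delta>': "\<delta>' > 0" "cball w \<delta>' \<subseteq> - G"
    using \<open>closed G\<close> open_contains_cball[of "- G"] by (auto simp: open_closed)
  obtain M where M: "spec_gap f lam \<delta>' M" using gap \<delta>' by blast
  have M0: "M > 0" using M by (simp add: spec_gap_def)
  obtain v where v: "\<And>j. dist w ((f ^^ (j * M)) v) \<le> \<delta>'"
    using spec_gap_visits[OF comp f M, of "\<lambda>j. j * M" w] by auto
  define H where "H = (\<Union>r<M. {z. dist w ((f ^^ r) z) \<le> \<delta>'})"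
  have "closed H" unfolding H_def
    by (intro closed_UN ballI closed_Collect_le fcont continuous_on_const) simp
  have vH: "(f ^^ n) v \<in> H" for n
  proof -
    obtain r c where "r < M" and c: "n + r = c * M" using exists_complement_to_multiple[OF M0] by blast
    have "(f ^^ r) ((f ^^ n) v) = (f ^^ (c * M)) v"
      unfolding c[symmetric] by (simp add: funpow_add add.commute[of n])
    then show ?thesis using v[of c] \<open>r < M\<close> unfolding H_def by (auto intro!: bexI[of _ r])
  qed
  have fE: "(f ^^ r) ` E \<subseteq> E" for r
  proof -
    have "(f ^^ r) ` E \<subseteq> closure ((f ^^ r) ` range (\<lambda>n. (f ^^ n) u))" unfolding E_def
      by (rule image_closure_subset) (auto intro: continuous_on_subset[OF continuous_on_funpow[OF f]] closure_subset[THEN subsetD])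
    also have "(f ^^ r) ` range (\<lambda>n. (f ^^ n) u) \<subseteq> range (\<lambda>n. (f ^^ n) u)"
      by (auto simp: image_iff) (metis comp_apply funpow_add)
    then have "closure ((f ^^ r) ` range (\<lambda>n. (f ^^ n) u)) \<subseteq> E" unfolding E_def by (rule closure_mono)
    finally show ?thesis .
  qed
  \<comment> \<open>E is forward invariant and contained in G, so its points never enter the ball
    around w; every point of H enters it within M steps.\<close>
  have "E \<inter> H = {}"
  proof (rule ccontr)
    assume "E \<inter> H \<noteq> {}"
    then obtain z r where "z \<in> E" "dist w ((f ^^ r) z) \<le> \<delta>'" by (auto simp: H_def)
    then have "(f ^^ r) z \<in> G" "(f ^^ r) z \<in> cball w \<delta>'" using fE EG by auto
    then show False using \<delta>' by auto
  qed
  have "compact E" "compact H"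
    using comp \<open>closed H\<close> compact_Int_closed[OF comp] by (auto simp: E_def)
  then have "compact (E \<times> H)" by (rule compact_Times)
  moreover have uv: "(f ^^ n) u \<in> E" "(f ^^ n) v \<in> H" for n
    by (auto simp: E_def vH intro!: closure_subset[THEN subsetD])
  then have "E \<times> H \<noteq> {}" by blast
  moreover have "continuous_on (E \<times> H) (\<lambda>z. dist (fst z) (snd z))"
    by (intro continuous_intros)
  ultimately have "\<exists>z\<in>E \<times> H. \<forall>z'\<in>E \<times> H. dist (fst z) (snd z) \<le> dist (fst z') (snd z')"
    by (rule continuous_attains_inf)
  then obtain z where z: "z \<in> E \<times> H" and
    min: "\<forall>z'\<in>E \<times> H. dist (fst z) (snd z) \<le> dist (fst z') (snd z')" ..
  have "fst z \<noteq> snd z" using z \<open>E \<inter> H = {}\<close> by auto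
  then show thesis
    using that[of "dist (fst z) (snd z)" u v] bspec[OF min, of "(x, y)" for x y] uv by simp
qed

section \<open>Subadditive cocycles\<close>

text \<open>\<open>tail_le\<close> is the trace of invertibility: deleting the first factor raises
  the value by at most K. It gives the invariance of \<open>slow\<close> and, iterated, lower bounds
  at the end of a block from lower bounds along the block.\<close>

locale bounded_subadditive_cocycle =
  fixes f :: "'a::metric_space \<Rightarrow> 'a" and \<phi> :: "nat \<Rightarrow> 'a \<Rightarrow> real" and K :: real
  assumes compact_UNIV: "compact (UNIV :: 'a set)"
    and continuous_f: "continuous_on UNIV f"
    and continuous_\<phi>: "continuous_on UNIV (\<phi> n)"
    and subadditive: "\<phi> (m + n) x \<le> \<phi> m x + \<phi> n ((f ^^ m) x)"
    and bounded: "\<bar>\<phi> n x\<bar> \<le> K * real n"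
    and tail_le: "\<phi> n (f x) \<le> \<phi> (Suc n) x + K"
begin

lemma K_nonneg: "0 \<le> K"
  using bounded[of 1 undefined] by linarith

lemma upper_bounded: "\<phi> n x \<le> K * real n"
  using bounded[of n x] by linarith

lemma lower_bounded: "- (K * real n) \<le> \<phi> n x"
  using bounded[of n x] by linarith

text \<open>By subadditivity of the maxima (Fekete) the infimum is also the limit. As an infimum it
  bounds the maximum from below at every n \<ge> 1, which \<open>growth_attained\<close>
  exploits.\<close>

definition growth :: real where
  "growth = (INF n\<in>{1..}. (SUP x. \<phi> n x) / real n)"

lemma bdd_above_range: "bdd_above (range (\<phi> n))"
  using upper_bounded by (auto intro!: bdd_aboveI)

lemma growth_le_SUP: "n \<ge> 1 \<Longrightarrow> growth \<le> (SUP x. \<phi> n x) / real n"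
  unfolding growth_def
proof (rule cINF_lower)
  show "bdd_below ((\<lambda>n. (SUP x. \<phi> n x) / real n) ` {1..})"
  proof (rule bdd_belowI2)
    fix n :: nat assume "n \<in> {1..}"
    then have "- K = - (K * real n) / real n" by simp
    also have "\<dots> \<le> \<phi> n undefined / real n" by (intro divide_right_mono lower_bounded) simp
    also have "\<dots> \<le> (SUP x. \<phi> n x) / real n"
      by (intro divide_right_mono cSUP_upper bdd_above_range) auto
    finally show "- K \<le> (SUP x. \<phi> n x) / real n" .
  qed
qed auto

lemma growth_attained:
  assumes "n \<ge> 1"
  obtains x where "growth * real n \<le> \<phi> n x"
proof -
  have "\<exists>x\<in>UNIV. \<forall>y\<in>UNIV. \<phi> n y \<le> \<phi> n x"
    by (rule continuous_attains_sup[OF compact_UNIV _ continuous_\<phi>]) simp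
  then obtain x where x: "\<And>y. \<phi> n y \<le> \<phi> n x" by blast
  then have "(SUP y. \<phi> n y) \<le> \<phi> n x" by (intro cSUP_least) auto
  then have "growth \<le> \<phi> n x / real n"
    using growth_le_SUP[OF assms] divide_right_mono[of "SUP y. \<phi> n y" "\<phi> n x" "real n"] by linarith
  then show thesis using assms that by (simp add: field_simps)
qed

lemma growth_upper:
  assumes "\<epsilon> > 0"
  obtains C where "\<And>n x. \<phi> n x \<le> (growth + \<epsilon>) * real n + C" "C \<ge> 0"
proof -
  define c where "c = growth + \<epsilon>"
  have "(INF n\<in>{1..}. (SUP x. \<phi> n x) / real n) < c"
    using assms by (simp add: c_def growth_def)
  then obtain N where N: "N \<ge> 1" "(SUP x. \<phi> N x) / real N < c"
    using cInf_lessD[of "(\<lambda>n. (SUP x. \<phi> n x) / real n) ` {1..}" c] by auto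
  have \<phi>N: "\<phi> N x \<le> c * real N" for x
  proof -
    have "\<phi> N x \<le> (SUP x. \<phi> N x)" by (intro cSUP_upper bdd_above_range) auto
    then show ?thesis using N by (simp add: field_simps)
  qed
  \<comment> \<open>Cutting off blocks of length N leaves a remainder shorter than N, whose value
    exceeds its share of c by at most K + \<bar>c\<bar> per step.\<close>
  define C where "C = (K + \<bar>c\<bar>) * real N"
  have "\<phi> n x \<le> c * real n + C" for n x
  proof (induction n arbitrary: x rule: less_induct)
    case (less n)
    show ?case
    proof (cases "n < N")
      case True
      have "\<phi> n x \<le> K * real n" by (rule upper_bounded)
      also have "\<dots> \<le> c * real n + (K + \<bar>c\<bar>) * real n"
        using mult_right_mono[of "0" "c + \<bar>c\<bar>" "real n"] by (simp add: algebra_simps)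
      also have "\<dots> \<le> c * real n + C" unfolding C_def
        using True K_nonneg by (intro add_left_mono mult_left_mono) auto
      finally show ?thesis .
    next
      case False
      then have n: "n = N + (n - N)" by simp
      have "\<phi> n x \<le> \<phi> N x + \<phi> (n - N) ((f ^^ N) x)"
        by (subst n) (rule subadditive)
      also have "\<dots> \<le> c * real N + (c * real (n - N) + C)"
        using False N(1) by (intro add_mono \<phi>N less) auto
      also have "\<dots> = c * real n + C" using False by (simp add: algebra_simps of_nat_diff)
      finally show ?thesis .
    qed
  qed
  moreover have "C \<ge> 0" using K_nonneg by (simp add: C_def)
  ultimately show thesis using that by (auto simp: c_def)
qed

section \<open>Birkhoff sums and robust segments of slow growth\<close>

lemma sum_lessThan_add: "(\<Sum>i<m + n. g i) = (\<Sum>i<m. g i) + (\<Sum>i<n. g (m + i) :: real)" for m n :: nat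
  by (induction n) auto

text \<open>Averaging the subadditivity over the N phases of a decomposition into blocks of length N.\<close>

lemma birkhoff_sum_bound:
  "real N * \<phi> (N + n) y \<le> (\<Sum>i<n. \<phi> N ((f ^^ i) y)) + 3 * K * real N * real N"
proof (cases "N = 0")
  case True
  then show ?thesis using bounded[of 0] by simp
next
  case False
  \<comment> \<open>Successive blocks of length N starting at the N phases use each term of the
    Birkhoff sum once. Removing one block from every phase moves the base point by N.\<close>
  have A: "(\<Sum>r<N. \<phi> n ((f ^^ r) y)) \<le> (\<Sum>i<n. \<phi> N ((f ^^ i) y)) + 2 * K * real N * real N" for n y
  proof (induction n arbitrary: y rule: less_induct)
    case (less n)
    show ?case
    proof (cases "n < N")
      case True
      have "(\<Sum>r<N. \<phi> n ((f ^^ r) y)) \<le> (\<Sum>r<N. K * real N)"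
        using True K_nonneg by (intro sum_mono order_trans[OF upper_bounded] mult_left_mono) auto
      moreover have "(\<Sum>i<n. - (K * real N)) \<le> (\<Sum>i<n. \<phi> N ((f ^^ i) y))"
        by (intro sum_mono lower_bounded)
      moreover have "real n * (K * real N) \<le> real N * (K * real N)"
        using True K_nonneg by (intro mult_right_mono) auto
      ultimately show ?thesis by (simp add: sum_negf algebra_simps)
    next
      case False
      define d where "d = n - N"
      have n: "n = N + d" and "d < n" using False \<open>N \<noteq> 0\<close> by (auto simp: d_def)
      have *: "(f ^^ i) ((f ^^ j) y) = (f ^^ (j + i)) y" for i j
        by (simp add: funpow_add add.commute[of j])
      have "(\<Sum>r<N. \<phi> n ((f ^^ r) y)) \<le> (\<Sum>r<N. \<phi> N ((f ^^ r) y) + \<phi> d ((f ^^ r) ((f ^^ N) y)))"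
      proof (intro sum_mono)
        fix r
        show "\<phi> n ((f ^^ r) y) \<le> \<phi> N ((f ^^ r) y) + \<phi> d ((f ^^ r) ((f ^^ N) y))"
          using subadditive[of N d "(f ^^ r) y"] unfolding n * by (simp add: add.commute[of r])
      qed
      also have "\<dots> \<le> (\<Sum>r<N. \<phi> N ((f ^^ r) y)) + ((\<Sum>i<d. \<phi> N ((f ^^ i) ((f ^^ N) y))) + 2 * K * real N * real N)"
        unfolding sum.distrib by (intro add_left_mono less \<open>d < n\<close>)
      also have "\<dots> = (\<Sum>i<n. \<phi> N ((f ^^ i) y)) + 2 * K * real N * real N"
        unfolding n sum_lessThan_add * by simp
      finally show ?thesis .
    qed
  qed
  \<comment> \<open>Phase r leaves r steps in front and N - r steps behind, together a cost of K *
    N.\<close>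
  have "(\<Sum>r<N. \<phi> (N + n) y) \<le> (\<Sum>r<N. K * real N + \<phi> n ((f ^^ r) y))"
  proof (intro sum_mono)
    fix r assume "r \<in> {..<N}"
    then have r: "N + n = r + (n + (N - r))" "real r + real (N - r) = real N" by auto
    have "\<phi> (N + n) y \<le> \<phi> r y + (\<phi> n ((f ^^ r) y) + \<phi> (N - r) ((f ^^ n) ((f ^^ r) y)))"
      unfolding r(1) by (intro order_trans[OF subadditive] add_left_mono subadditive)
    also have "\<dots> \<le> K * real r + (\<phi> n ((f ^^ r) y) + K * real (N - r))"
      by (intro add_mono upper_bounded order_refl)
    also have "\<dots> = K * real N + \<phi> n ((f ^^ r) y)"
      unfolding r(2)[symmetric] by (simp add: algebra_simps)
    finally show "\<phi> (N + n) y \<le> K * real N + \<phi> n ((f ^^ r) y)" .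
  qed
  then have "real N * \<phi> (N + n) y \<le> real N * (K * real N) + (\<Sum>r<N. \<phi> n ((f ^^ r) y))"
    by (simp add: sum.distrib)
  then show ?thesis using A[where n=n and y=y] by (simp add: algebra_simps)
qed

lemma integrable_continuous:
  fixes g :: "'a \<Rightarrow> real"
  assumes "invariant_measure f \<mu>" "continuous_on UNIV g"
  shows "integrable \<mu> g"
proof -
  interpret prob_space \<mu> using assms by (simp add: invariant_measure_def)
  have s: "sets \<mu> = sets borel" using assms by (simp add: invariant_measure_def)
  have "bounded (range g)"
    using compact_imp_bounded[OF compact_continuous_image[OF assms(2) compact_UNIV]] .
  then obtain B where "\<And>x. norm (g x) \<le> B" unfolding bounded_iff by blast
  moreover have "g \<in> borel_measurable \<mu>"
    using borel_measurable_continuous_onI[OF assms(2)] measurable_cong_sets[OF s refl] by blast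
  ultimately show ?thesis by (intro integrable_const_bound[of _ B]) auto
qed

lemma integral_shift:
  fixes g :: "'a \<Rightarrow> real"
  assumes "invariant_measure f \<mu>" "g \<in> borel_measurable borel"
  shows "(\<integral>x. g ((f ^^ i) x) \<partial>\<mu>) = (\<integral>x. g x \<partial>\<mu>)"
proof (induction i)
  case (Suc i)
  have s: "sets \<mu> = sets borel" and fm: "f \<in> measurable \<mu> \<mu>" and inv: "distr \<mu> \<mu> f = \<mu>"
    using assms by (auto simp: invariant_measure_def)
  have "(f ^^ i) \<in> borel_measurable borel"
    by (intro borel_measurable_continuous_onI continuous_on_funpow continuous_f)
  then have "(\<lambda>x. g ((f ^^ i) x)) \<in> borel_measurable \<mu>"
    using measurable_compose[OF _ assms(2)] measurable_cong_sets[OF s refl] by blast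
  then have "(\<integral>x. g ((f ^^ i) x) \<partial>(distr \<mu> \<mu> f)) = (\<integral>x. g ((f ^^ i) (f x)) \<partial>\<mu>)"
    by (intro integral_distr fm)
  then show ?case using Suc inv by (simp add: funpow_swap1)
qed simp

text \<open>Some point has a Birkhoff sum not above its mean, and uniform continuity of the one
  function \<phi> N transfers this to all points shadowing it. Hence \<delta> does not depend on the
  length of the segment.\<close>

lemma low_growth_segments:
  assumes inv: "invariant_measure f \<mu>" and N: "N \<ge> 1" and a: "(\<integral>x. \<phi> N x \<partial>\<mu>) < a * real N"
  obtains \<delta> C where "\<delta> > 0"
    "\<And>n. \<exists>x. \<forall>y. (\<forall>i\<le>N + n. dist ((f ^^ i) x) ((f ^^ i) y) \<le> \<delta>) \<longrightarrow> \<phi> (N + n) y \<le> a * real n + C"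
proof -
  interpret prob_space \<mu> using inv by (simp add: invariant_measure_def)
  define I where "I = (\<integral>x. \<phi> N x \<partial>\<mu>)"
  define S where "S n x = (\<Sum>i<n. \<phi> N ((f ^^ i) x))" for n x
  have "uniformly_continuous_on UNIV (\<phi> N)"
    by (intro compact_uniformly_continuous continuous_\<phi> compact_UNIV)
  then obtain d where d: "d > 0" "\<And>x y. dist x y < d \<Longrightarrow> dist (\<phi> N x) (\<phi> N y) < a * real N - I"
    using a unfolding uniformly_continuous_on_def I_def by (metis diff_gt_0_iff_gt UNIV_I)
  have int: "integrable \<mu> (\<lambda>x. \<phi> N ((f ^^ i) x))" for i
    by (intro integrable_continuous[OF inv] continuous_on_compose2[OF continuous_\<phi> continuous_on_funpow[OF continuous_f]]) simp
  have "\<exists>x. S n x \<le> real n * I" for n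
  proof (rule ccontr)
    assume "\<not> ?thesis"
    then have "\<And>x. real n * I < S n x" by (simp add: not_le)
    then have "real n * I < (\<integral>x. S n x \<partial>\<mu>)"
      using int by (intro expectation_greater) (auto simp: S_def)
    also have "\<dots> = (\<Sum>i<n. \<integral>x. \<phi> N ((f ^^ i) x) \<partial>\<mu>)"
      unfolding S_def by (intro Bochner_Integration.integral_sum int)
    also have "\<dots> = real n * I"
      using integral_shift[OF inv borel_measurable_continuous_onI[OF continuous_\<phi>]] by (simp add: I_def)
    finally show False by simp
  qed
  then obtain x where x: "\<And>n. S n (x n) \<le> real n * I" by metis
  show thesis
  proof
    show "d / 2 > 0" using d by simp
    fix n
    show "\<exists>x. \<forall>y. (\<forall>i\<le>N + n. dist ((f ^^ i) x) ((f ^^ i) y) \<le> d / 2)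
      \<longrightarrow> \<phi> (N + n) y \<le> a * real n + 3 * K * real N"
    proof (intro exI[of _ "x n"] allI impI)
      fix y assume y: "\<forall>i\<le>N + n. dist ((f ^^ i) (x n)) ((f ^^ i) y) \<le> d / 2"
      have "S n y \<le> (\<Sum>i<n. \<phi> N ((f ^^ i) (x n)) + (a * real N - I))"
        unfolding S_def
      proof (intro sum_mono)
        fix i assume "i \<in> {..<n}"
        then have "dist ((f ^^ i) (x n)) ((f ^^ i) y) \<le> d / 2" using y by simp
        then have "dist ((f ^^ i) (x n)) ((f ^^ i) y) < d" using d(1) by linarith
        from d(2)[OF this] show "\<phi> N ((f ^^ i) y) \<le> \<phi> N ((f ^^ i) (x n)) + (a * real N - I)"
          by (simp add: dist_real_def)
      qed
      also have "\<dots> = S n (x n) + real n * (a * real N - I)"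
        by (simp add: S_def sum.distrib)
      also have "\<dots> \<le> real n * (a * real N)"
        using x[of n] by (simp add: algebra_simps)
      finally have "real N * \<phi> (N + n) y \<le> real n * (a * real N) + 3 * K * real N * real N"
        using birkhoff_sum_bound[of N n y] by (simp add: S_def)
      then have "real N * \<phi> (N + n) y \<le> real N * (a * real n + 3 * K * real N)"
        by (simp add: algebra_simps)
      then show "\<phi> (N + n) y \<le> a * real n + 3 * K * real N"
        using N by (simp add: mult_le_cancel_left)
    qed
  qed
qed

text \<open>The covering argument of Katznelson and Weiss: outside a set of small measure every orbit
  starts with a block of length at most m along which the growth is slow.\<close>

lemma covering_bound:
  assumes E: "E = {x. \<forall>n\<in>{1..m}. c * real n < \<phi> n x}"
  shows "\<phi> n x \<le> c * real n + (K + \<bar>c\<bar>) * (\<Sum>i<n. indicator E ((f ^^ i) x)) + (K + \<bar>c\<bar>) * real m"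
proof (induction n arbitrary: x rule: less_induct)
  case (less n)
  \<comment> \<open>D is chosen with K \<le> c + D: a step at a point of E costs at most c + D, and
    a remainder of at most m steps costs at most D * m beyond its share of c.\<close>
  define D where "D = K + \<bar>c\<bar>"
  have D: "D \<ge> 0" "K \<le> c + D" using K_nonneg by (auto simp: D_def)
  define T where "T n x = (\<Sum>i<n. indicator E ((f ^^ i) x) :: real)" for n x
  have T0: "T n x \<ge> 0" for n x by (simp add: T_def sum_nonneg)
  have Tadd: "T (k + l) x = T k x + T l ((f ^^ k) x)" for k l x
    unfolding T_def sum_lessThan_add by (simp add: funpow_add add.commute[of k])
  have IH: "\<phi> l z \<le> c * real l + D * T l z + D * real m" if "l < n" for l z
    using less[OF that] by (simp add: D_def T_def)
  consider "n \<le> m" | "n > m" "x \<in> E" | k where "k \<in> {1..m}" "\<phi> k x \<le> c * real k" "n > m"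
    unfolding E by fastforce
  then have "\<phi> n x \<le> c * real n + D * T n x + D * real m"
  proof cases
    case 1
    have "\<phi> n x \<le> K * real n" by (rule upper_bounded)
    also have "\<dots> \<le> (c + D) * real n" using D by (intro mult_right_mono) auto
    also have "\<dots> \<le> c * real n + D * real m"
      using 1 D mult_left_mono[of "real n" "real m" D] by (simp add: algebra_simps)
    also have "\<dots> \<le> c * real n + D * T n x + D * real m" using D T0[of n x] by simp
    finally show ?thesis .
  next
    case 2
    then have n: "n = 1 + (n - 1)" by simp
    have "\<phi> n x \<le> \<phi> 1 x + \<phi> (n - 1) ((f ^^ 1) x)" by (subst n) (rule subadditive)
    also have "\<dots> \<le> K * real 1 + (c * real (n - 1) + D * T (n - 1) ((f ^^ 1) x) + D * real m)"
      using 2 by (intro add_mono upper_bounded IH) auto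
    also have "\<dots> \<le> (c + D) + (c * real (n - 1) + D * T (n - 1) ((f ^^ 1) x) + D * real m)"
      using D by simp
    also have "\<dots> = c * real n + D * (T 1 x + T (n - 1) ((f ^^ 1) x)) + D * real m"
      using 2 by (simp add: T_def algebra_simps of_nat_diff)
    also have "T 1 x + T (n - 1) ((f ^^ 1) x) = T n x" using Tadd[of 1 "n - 1" x] n by simp
    finally show ?thesis .
  next
    case (3 k)
    then have n: "n = k + (n - k)" by simp
    have "\<phi> n x \<le> \<phi> k x + \<phi> (n - k) ((f ^^ k) x)" by (subst n) (rule subadditive)
    also have "\<dots> \<le> c * real k + (c * real (n - k) + D * T (n - k) ((f ^^ k) x) + D * real m)"
      using 3 by (intro add_mono IH) auto
    also have "\<dots> = c * real n + D * T (n - k) ((f ^^ k) x) + D * real m"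
      using 3 by (simp add: algebra_simps of_nat_diff)
    also have "\<dots> \<le> c * real n + D * (T k x + T (n - k) ((f ^^ k) x)) + D * real m"
      using D T0[of k x] by (simp add: distrib_left)
    also have "T k x + T (n - k) ((f ^^ k) x) = T n x" using Tadd[of k "n - k" x] n by simp
    finally show ?thesis .
  qed
  then show ?case by (simp add: D_def T_def)
qed

text \<open>The slack 1 / Suc j absorbs the bounded differences between the values at x and at f x, so that this
  set is invariant on the nose, as the definition of ergodicity requires.\<close>

definition slow :: "real \<Rightarrow> 'a set" where
  "slow c = {x. \<exists>j::nat. \<forall>m. \<exists>n>m. \<phi> n x \<le> (c - 1 / real (Suc j)) * real n}"

lemma slow_invariant: "f -` slow c = slow c"
proof -
  have aux: "x \<in> slow c"
    if sl: "y \<in> slow c" and le: "\<And>n. n > 0 \<Longrightarrow> \<exists>n'\<ge>n-1. n' \<le> n + 1 \<and> \<phi> n' x \<le> \<phi> n y + K" for x y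
  proof -
    obtain j :: nat where j: "\<And>m. \<exists>n>m. \<phi> n y \<le> (c - 1 / real (Suc j)) * real n"
      using sl by (auto simp: slow_def)
    define s where "s = c - 1 / real (Suc j)"
    define s' where "s' = c - 1 / real (Suc (Suc j))"
    have "s < s'" by (auto simp: s_def s'_def intro!: divide_strict_left_mono)
    have "\<exists>n'>m. \<phi> n' x \<le> s' * real n'" for m
    proof -
      \<comment> \<open>For n beyond M the gain (s' - s) * n covers the error K in the value and the
        error \<bar>s'\<bar> from changing the length by one.\<close>
      obtain M :: nat where M: "real M > (K + \<bar>s'\<bar>) / (s' - s)" using reals_Archimedean2 by blast
      obtain n where n: "n > max M (m + 1)" "\<phi> n y \<le> s * real n"
        using j[of "max M (m + 1)"] by (auto simp: s_def)
      obtain n' where n': "n' \<ge> n - 1" "n' \<le> n + 1" "\<phi> n' x \<le> \<phi> n y + K" using le[of n] n by auto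
      have "(K + \<bar>s'\<bar>) / (s' - s) < real n" using M n by linarith
      then have big: "K + \<bar>s'\<bar> < (s' - s) * real n" using \<open>s < s'\<close> by (simp add: field_simps)
      have "\<bar>real n - real n'\<bar> \<le> 1" using n' by linarith
      then have "\<bar>s' * (real n - real n')\<bar> \<le> \<bar>s'\<bar>" 
        by (metis abs_mult mult.right_neutral mult_left_mono abs_ge_zero)
      then have "s' * real n - \<bar>s'\<bar> \<le> s' * real n'" unfolding right_diff_distrib by linarith
      moreover have "\<phi> n' x \<le> s * real n + K" using n' n by linarith
      ultimately have "\<phi> n' x \<le> s' * real n'" using big by (simp add: algebra_simps)
      moreover have "n' > m" using n(1) n'(1) by arith
      ultimately show ?thesis by blast
    qed
    then show ?thesis unfolding slow_def s'_def by blast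
  qed
  have "f x \<in> slow c" if "x \<in> slow c" for x
  proof (rule aux[OF that])
    fix n :: nat assume "n > 0"
    then have "\<phi> (n - 1) (f x) \<le> \<phi> n x + K" using tail_le[of "n - 1" x] by simp
    then show "\<exists>n'\<ge>n - 1. n' \<le> n + 1 \<and> \<phi> n' (f x) \<le> \<phi> n x + K" by (intro exI[of _ "n - 1"]) auto
  qed
  moreover have "x \<in> slow c" if "f x \<in> slow c" for x
  proof (rule aux[OF that])
    fix n :: nat assume "n > 0"
    have "\<phi> (Suc n) x \<le> \<phi> n (f x) + K"
      using subadditive[of 1 n x] upper_bounded[of 1 x] by simp
    then show "\<exists>n'\<ge>n - 1. n' \<le> n + 1 \<and> \<phi> n' x \<le> \<phi> n (f x) + K" by (intro exI[of _ "Suc n"]) auto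
  qed
  ultimately show ?thesis by blast
qed

text \<open>If \<open>slow c\<close> had full measure, the sets \<open>E m\<close> would shrink to a
  null set. Integrating the covering bound would then give an integral of \<phi> n of at most (c + D
  * measure \<mu> (E m)) * n + D * m, with a rate below \<open>growth\<close> for suitable m.
  Ergodicity leaves only measure 0.\<close>

lemma slow_null:
  assumes erg: "ergodic_measure f \<mu>" and int: "\<And>N. N \<ge> 1 \<Longrightarrow> growth * real N \<le> (\<integral>x. \<phi> N x \<partial>\<mu>)"
    and c: "c < growth"
  shows "slow c \<in> null_sets \<mu>"
proof -
  have inv: "invariant_measure f \<mu>" using erg by (simp add: ergodic_measure_def)
  interpret prob_space \<mu> using inv by (simp add: invariant_measure_def)
  have [measurable_cong]: "sets \<mu> = sets borel" using inv by (simp add: invariant_measure_def)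
  have sp: "space \<mu> = UNIV" using sets_eq_imp_space_eq[of \<mu> borel] by (simp add: \<open>sets \<mu> = sets borel\<close>)
  have [measurable]: "\<phi> n \<in> borel_measurable borel" for n
    by (intro borel_measurable_continuous_onI continuous_\<phi>)
  have [measurable]: "(f ^^ n) \<in> borel_measurable borel" for n
    by (intro borel_measurable_continuous_onI continuous_on_funpow continuous_f)
  have meas: "slow c \<in> sets \<mu>"
  proof -
    have "{x \<in> space \<mu>. \<exists>j::nat. \<forall>m. \<exists>n>m. \<phi> n x \<le> (c - 1 / real (Suc j)) * real n} \<in> sets \<mu>"
      by measurable
    then show ?thesis by (simp add: slow_def sp)
  qed
  have "measure \<mu> (slow c) \<noteq> 1"
  proof
    assume one: "measure \<mu> (slow c) = 1"
    define E where "E m = {x. \<forall>n\<in>{1..m}. c * real n < \<phi> n x}" for m :: nat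
    have Em [measurable]: "E m \<in> sets \<mu>" for m
    proof -
      have "{x \<in> space \<mu>. \<forall>n\<in>{1..m}. c * real n < \<phi> n x} \<in> sets \<mu>" by measurable
      then show ?thesis by (simp add: E_def sp)
    qed
    have "(\<lambda>m. measure \<mu> (E m)) \<longlonglongrightarrow> measure \<mu> (\<Inter>m. E m)"
      using Em by (intro finite_Lim_measure_decseq decseq_SucI) (auto simp: E_def)
    moreover have "measure \<mu> (\<Inter>m. E m) = 0"
    proof -
      have "(\<Inter>m. E m) \<subseteq> space \<mu> - slow c"
      proof
        fix x assume x: "x \<in> (\<Inter>m. E m)"
        have "x \<notin> slow c"
        proof
          assume "x \<in> slow c"
          then obtain j where "\<forall>m. \<exists>n>m. \<phi> n x \<le> (c - 1 / real (Suc j)) * real n"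
            unfolding slow_def by blast
          then obtain n where n: "n > 0" "\<phi> n x \<le> (c - 1 / real (Suc j)) * real n" by blast
          have "(c - 1 / real (Suc j)) * real n \<le> c * real n" by (intro mult_right_mono) auto
          moreover have "x \<in> E n" using x by blast
          then have "c * real n < \<phi> n x" using n(1) by (simp add: E_def)
          ultimately show False using n by linarith
        qed
        then show "x \<in> space \<mu> - slow c" by (simp add: sp)
      qed
      then have "measure \<mu> (\<Inter>m. E m) \<le> measure \<mu> (space \<mu> - slow c)"
        using meas by (intro finite_measure_mono) auto
      then show ?thesis using prob_compl[OF meas] one by (simp add: measure_le_0_iff)
    qed
    ultimately have lim: "(\<lambda>m. measure \<mu> (E m)) \<longlonglongrightarrow> 0" by simp
    define D where "D = K + \<bar>c\<bar>"
    have D: "D \<ge> 0" using K_nonneg by (simp add: D_def)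
    have "(\<lambda>m. c + D * measure \<mu> (E m)) \<longlonglongrightarrow> c + D * 0" by (intro tendsto_intros lim)
    then have "eventually (\<lambda>m. c + D * measure \<mu> (E m) < growth) sequentially"
      using c by (intro order_tendstoD) auto
    then obtain m where m: "c + D * measure \<mu> (E m) < growth" unfolding eventually_sequentially by auto
    have "growth * real n \<le> (c + D * measure \<mu> (E m)) * real n + D * real m" if n: "n \<ge> 1" for n
    proof -
      have iE: "integrable \<mu> (\<lambda>x. indicator (E m) ((f ^^ i) x) :: real)" for i
      proof (rule integrable_const_bound[of _ 1])
        show "AE x in \<mu>. norm (indicator (E m) ((f ^^ i) x) :: real) \<le> 1" by (simp add: indicator_def)
        have [measurable]: "E m \<in> sets borel" using Em by (simp add: \<open>sets \<mu> = sets borel\<close>)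
        show "(\<lambda>x. indicator (E m) ((f ^^ i) x) :: real) \<in> borel_measurable \<mu>" by measurable
      qed
      have "growth * real n \<le> (\<integral>x. \<phi> n x \<partial>\<mu>)" by (rule int[OF n])
      also have "\<dots> \<le> (\<integral>x. c * real n + D * (\<Sum>i<n. indicator (E m) ((f ^^ i) x)) + D * real m \<partial>\<mu>)"
        using iE integrable_continuous[OF inv continuous_\<phi>] covering_bound[OF E_def]
        by (intro integral_mono) (auto simp: D_def)
      also have "\<dots> = c * real n + D * (\<Sum>i<n. \<integral>x. indicator (E m) ((f ^^ i) x) \<partial>\<mu>) + D * real m"
        using iE by (simp add: prob_space)
      also have "(\<Sum>i<n. \<integral>x. indicator (E m) ((f ^^ i) x) \<partial>\<mu>) = real n * measure \<mu> (E m)"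
      proof -
        have "(\<integral>x. indicator (E m) ((f ^^ i) x) \<partial>\<mu>) = measure \<mu> (E m)" for i
          using integral_shift[OF inv, of "indicator (E m)" i] Em
          by (simp add: \<open>sets \<mu> = sets borel\<close> sp)
        then show ?thesis by simp
      qed
      finally show ?thesis by (simp add: algebra_simps)
    qed
    then have *: "(growth - (c + D * measure \<mu> (E m))) * real n \<le> D * real m" if "n \<ge> 1" for n
      using that by (simp add: algebra_simps)
    obtain n :: nat where "real n > D * real m / (growth - (c + D * measure \<mu> (E m)))"
      using reals_Archimedean2 by blast
    then have n: "D * real m < (growth - (c + D * measure \<mu> (E m))) * real n"
      using m by (simp add: pos_divide_less_eq mult.commute)
    moreover have "n \<ge> 1"
    proof (rule ccontr)
      assume "\<not> n \<ge> 1"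
      then have "n = 0" by simp
      then show False using n D by (auto simp: mult_less_0_iff)
    qed
    ultimately show False using *[of n] by linarith
  qed
  then have "measure \<mu> (slow c) = 0"
    using erg meas slow_invariant unfolding ergodic_measure_def by blast
  then have "emeasure \<mu> (slow c) = 0" unfolding emeasure_eq_measure by simp
  then show ?thesis using meas by (rule null_setsI)
qed

text \<open>The upper bound holds at every point by \<open>growth_upper\<close>; only the lower
  bound needs the measure.\<close>

lemma ergodic_limit:
  assumes erg: "ergodic_measure f \<mu>" and int: "\<And>N. N \<ge> 1 \<Longrightarrow> growth * real N \<le> (\<integral>x. \<phi> N x \<partial>\<mu>)"
  shows "AE x in \<mu>. (\<lambda>n. \<phi> n x / real n) \<longlonglongrightarrow> growth"
proof -
  have "AE x in \<mu>. x \<notin> slow (growth - 1 / real (Suc j))" for j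
    by (intro AE_not_in slow_null[OF erg int]) auto
  then have "AE x in \<mu>. \<forall>j. x \<notin> slow (growth - 1 / real (Suc j))"
    by (subst AE_all_countable) simp
  then show ?thesis
  proof (rule AE_mp, intro AE_I2 impI)
    fix x assume x: "\<forall>j. x \<notin> slow (growth - 1 / real (Suc j))"
    show "(\<lambda>n. \<phi> n x / real n) \<longlonglongrightarrow> growth"
    proof (rule LIMSEQ_I)
      fix e :: real assume e: "e > 0"
      \<comment> \<open>With s = 1 / Suc j, lying outside \<open>slow (growth - s)\<close> is tested
        at slack s, giving eventually \<phi> n x > (growth - 2 * s) * n; hence the bound e / 2 for
        s.\<close>
      then obtain j where j: "1 / real (Suc j) < e / 2" using nat_approx_posE[of "e / 2"] by auto
      have "\<not> (\<forall>m. \<exists>n>m. \<phi> n x \<le> (growth - 1 / real (Suc j) - 1 / real (Suc j)) * real n)"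
        using x unfolding slow_def by blast
      then obtain m where m: "\<And>n. n > m \<Longrightarrow> (growth - 1 / real (Suc j) - 1 / real (Suc j)) * real n < \<phi> n x"
        by (meson not_le)
      obtain C where C: "\<And>n x. \<phi> n x \<le> (growth + e / 2) * real n + C" "C \<ge> 0"
        using growth_upper[of "e / 2"] e by auto
      obtain M :: nat where M: "real M > C / (e / 2)" using reals_Archimedean2 by blast
      show "\<exists>no. \<forall>n\<ge>no. norm (\<phi> n x / real n - growth) < e"
      proof (intro exI[of _ "Suc (max m M)"] allI impI)
        fix n assume n: "n \<ge> Suc (max m M)"
        then have n0: "real n > 0" by simp
        have "(growth - e) * real n \<le> (growth - 1 / real (Suc j) - 1 / real (Suc j)) * real n"
          using j by (intro mult_right_mono) auto
        also have "\<dots> < \<phi> n x" using n by (intro m) simp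
        finally have lo: "(growth - e) * real n < \<phi> n x" .
        have "C / (e / 2) < real n" using M n by linarith
        then have "C < e / 2 * real n" using e by (simp add: field_simps)
        then have hi: "\<phi> n x < (growth + e) * real n" using C(1)[of n x] by (simp add: algebra_simps)
        have "growth - e < \<phi> n x / real n" "\<phi> n x / real n < growth + e"
          using lo hi n0 by (simp_all add: pos_less_divide_eq pos_divide_less_eq)
        then show "norm (\<phi> n x / real n - growth) < e" by (simp add: abs_less_iff)
      qed
    qed
  qed
qed

end

section \<open>Linear cocycles\<close>

text \<open>For bounded operators \<open>norm\<close> is the operator norm, so submultiplicativity
  is at hand.\<close>

primrec op_cocycle :: "('a \<Rightarrow> 'v::real_normed_vector \<Rightarrow>\<^sub>L 'v) \<Rightarrow> ('a \<Rightarrow> 'a) \<Rightarrow> nat \<Rightarrow> 'a \<Rightarrow> 'v \<Rightarrow>\<^sub>L 'v" where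
  "op_cocycle B f 0 x = id_blinfun"
| "op_cocycle B f (Suc n) x = B ((f ^^ n) x) o\<^sub>L op_cocycle B f n x"

lemma op_cocycle_add:
  "op_cocycle B f (m + n) x = op_cocycle B f n ((f ^^ m) x) o\<^sub>L op_cocycle B f m x"
  by (induction n) (auto intro!: blinfun_eqI simp: funpow_add add.commute[of m])

lemma op_cocycle_Suc_right:
  "op_cocycle B f (Suc n) x = op_cocycle B f n (f x) o\<^sub>L B x"
  using op_cocycle_add[of B f 1 n x] by (auto intro!: blinfun_eqI)

lemma op_cocycle_scaleR:
  "op_cocycle (\<lambda>z. c *\<^sub>R B z) f n x = c ^ n *\<^sub>R op_cocycle B f n x"
  by (induction n) (auto intro!: blinfun_eqI simp: blinfun.scaleR_left blinfun.scaleR_right)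

lemma norm_compose3:
  "norm (P o\<^sub>L Q o\<^sub>L R) \<le> norm P * norm Q * norm R"
  by (meson norm_blinfun_compose order_trans mult_right_mono norm_ge_zero)

text \<open>The factors of the cocycle along the orbit of x are replaced by those along the orbit of y from the
  left end up to the midpoint m, and then in the second half, again from left to right. In each
  step the uniform growth bound is applied to the shorter of the two outer factors only.\<close>

lemma op_cocycle_perturbation:
  fixes B :: "'a \<Rightarrow> 'v::real_normed_vector \<Rightarrow>\<^sub>L 'v"
  assumes d: "\<And>i. i < n \<Longrightarrow> norm (B ((f ^^ i) y) - B ((f ^^ i) x)) \<le> d i"
    and L: "\<And>i k. i + k \<le> n \<Longrightarrow> norm (op_cocycle B f k ((f ^^ i) x)) \<le> norm (op_cocycle B f n x)"
    and U: "\<And>k z. norm (op_cocycle B f k z) \<le> U k"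
    and m: "m \<le> n" and s: "0 \<le> s" "s \<le> 1 / 5"
    and s1: "(\<Sum>i<m. d i * U i) \<le> s" and s2: "(\<Sum>i<n - m. U (n - 1 - (m + i)) * d (m + i)) \<le> s"
  shows "norm (op_cocycle B f n x) / 2 \<le> norm (op_cocycle B f n y)"
proof -
  let ?c = "op_cocycle B f"
  define l where "l = norm (?c n x)"
  have l0: "l \<ge> 0" by (simp add: l_def)
  have d0: "d i \<ge> 0" if "i < n" for i using d[OF that] norm_ge_zero order_trans by blast
  have U0: "U k \<ge> 0" for k using U[of k x] norm_ge_zero order_trans by blast
  \<comment> \<open>Raising j by one changes one factor: the product after it runs along x and is
    dominated by l, the product before it runs along y and has length j.\<close>
  have first: "norm ((?c (k - j) ((f ^^ j) x) o\<^sub>L ?c j y) - ?c k x) \<le> l * (\<Sum>i<j. d i * U i)"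
    if "j \<le> k" "k \<le> n" for j k
    using that(1)
  proof (induction j)
    case 0
    have "(?c k x o\<^sub>L id_blinfun) - ?c k x = 0" by (auto intro!: blinfun_eqI simp: blinfun.diff_left)
    then show ?case by simp
  next
    case (Suc j)
    define P where "P = ?c (k - Suc j) ((f ^^ Suc j) x)"
    have kj: "k - j = Suc (k - Suc j)" using Suc by simp
    have 1: "?c (k - j) ((f ^^ j) x) = P o\<^sub>L B ((f ^^ j) x)"
      unfolding kj op_cocycle_Suc_right P_def by simp
    have "(P o\<^sub>L ?c (Suc j) y) - ?c k x =
      (P o\<^sub>L (B ((f ^^ j) y) - B ((f ^^ j) x)) o\<^sub>L ?c j y) + ((?c (k - j) ((f ^^ j) x) o\<^sub>L ?c j y) - ?c k x)"
      unfolding 1 by (auto intro!: blinfun_eqI simp: blinfun.diff_left blinfun.add_left blinfun.diff_right)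
    then have "norm ((P o\<^sub>L ?c (Suc j) y) - ?c k x) \<le>
      norm (P o\<^sub>L (B ((f ^^ j) y) - B ((f ^^ j) x)) o\<^sub>L ?c j y) + norm ((?c (k - j) ((f ^^ j) x) o\<^sub>L ?c j y) - ?c k x)"
      by (metis norm_triangle_ineq)
    also have "\<dots> \<le> l * d j * U j + l * (\<Sum>i<j. d i * U i)"
    proof (intro add_mono order_trans[OF norm_compose3] mult_mono)
      show "norm P \<le> l" unfolding P_def l_def using Suc that(2) by (intro L) simp
      show "norm (B ((f ^^ j) y) - B ((f ^^ j) x)) \<le> d j" using Suc that(2) by (intro d) simp
      show "norm (?c j y) \<le> U j" by (rule U)
      show "norm ((?c (k - j) ((f ^^ j) x) o\<^sub>L ?c j y) - ?c k x) \<le> l * (\<Sum>i<j. d i * U i)"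
        using Suc by simp
    qed (use l0 d0 Suc that(2) in auto)
    finally show ?case by (simp add: P_def algebra_simps)
  qed
  \<comment> \<open>The hybrid product follows y up to time m and x from there to time k.\<close>
  define h where "h k = ?c (k - m) ((f ^^ m) x) o\<^sub>L ?c m y" for k
  have hk: "norm (h k - ?c k x) \<le> l * s" if "m \<le> k" "k \<le> n" for k
    using first[OF that] mult_left_mono[OF s1 l0] by (simp add: h_def)
  have hl: "norm (h k) \<le> l * (1 + s)" if "m \<le> k" "k \<le> n" for k
  proof -
    have "norm (h k) \<le> norm (?c k x) + norm (h k - ?c k x)" using norm_triangle_sub by blast
    also have "\<dots> \<le> l + l * s" using L[of 0 k] that hk by (intro add_mono) (auto simp: l_def)
    finally show ?thesis by (simp add: algebra_simps)
  qed
  \<comment> \<open>Now the product before the changed factor is a hybrid, at most l * (1 + s) by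
    the first half, and the one after it runs along y with length n - 1 - (m + t).\<close>
  have second: "norm ((?c (n - (m + t)) ((f ^^ (m + t)) y) o\<^sub>L h (m + t)) - ?c n y)
      \<le> l * (1 + s) * (\<Sum>i<t. U (n - 1 - (m + i)) * d (m + i))" if "m + t \<le> n" for t
    using that
  proof (induction t)
    case 0
    have "?c n y = ?c (n - m) ((f ^^ m) y) o\<^sub>L ?c m y" 
      using op_cocycle_add[of B f m "n - m" y] m by simp
    moreover have "h m = ?c m y" unfolding h_def by (auto intro!: blinfun_eqI)
    ultimately show ?case by simp
  next
    case (Suc t)
    define j where "j = m + t"
    have j: "j < n" "m \<le> j" using Suc by (auto simp: j_def)
    define P where "P = ?c (n - Suc j) ((f ^^ Suc j) y)"
    have nj: "n - j = Suc (n - Suc j)" "Suc j - m = Suc (j - m)" using j by auto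
    have 1: "?c (n - j) ((f ^^ j) y) = P o\<^sub>L B ((f ^^ j) y)"
      unfolding nj op_cocycle_Suc_right P_def by simp
    have ff: "(f ^^ (j - m)) ((f ^^ m) x) = (f ^^ j) x"
      using j by (metis comp_apply funpow_add le_add_diff_inverse2)
    have 2: "h (Suc j) = B ((f ^^ j) x) o\<^sub>L h j"
      unfolding h_def nj by (auto intro!: blinfun_eqI simp: ff)
    have "(P o\<^sub>L h (Suc j)) - ?c n y =
      (P o\<^sub>L (B ((f ^^ j) x) - B ((f ^^ j) y)) o\<^sub>L h j) + ((?c (n - j) ((f ^^ j) y) o\<^sub>L h j) - ?c n y)"
      unfolding 1 2 by (auto intro!: blinfun_eqI simp: blinfun.diff_left blinfun.add_left blinfun.diff_right)
    then have "norm ((P o\<^sub>L h (Suc j)) - ?c n y) \<le>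
      norm (P o\<^sub>L (B ((f ^^ j) x) - B ((f ^^ j) y)) o\<^sub>L h j) + norm ((?c (n - j) ((f ^^ j) y) o\<^sub>L h j) - ?c n y)"
      by (metis norm_triangle_ineq)
    also have "\<dots> \<le> U (n - 1 - j) * d j * (l * (1 + s)) + l * (1 + s) * (\<Sum>i<t. U (n - 1 - (m + i)) * d (m + i))"
    proof (intro add_mono order_trans[OF norm_compose3] mult_mono)
      show "norm P \<le> U (n - 1 - j)" using U[of "n - Suc j"] by (simp add: P_def)
      show "norm (B ((f ^^ j) x) - B ((f ^^ j) y)) \<le> d j" using d[OF j(1)] by (simp add: norm_minus_commute)
      show "norm (h j) \<le> l * (1 + s)" using j by (intro hl) auto
      show "norm ((?c (n - j) ((f ^^ j) y) o\<^sub>L h j) - ?c n y)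
        \<le> l * (1 + s) * (\<Sum>i<t. U (n - 1 - (m + i)) * d (m + i))" using Suc by (simp add: j_def)
    qed (use U0 d0 j in auto)
    finally show ?case by (simp add: P_def j_def algebra_simps)
  qed
  have "norm (h n - ?c n y) \<le> l * (1 + s) * s"
  proof -
    have "norm ((id_blinfun o\<^sub>L h n) - ?c n y) \<le> l * (1 + s) * (\<Sum>i<n - m. U (n - 1 - (m + i)) * d (m + i))"
      using second[of "n - m"] m by simp
    moreover have "id_blinfun o\<^sub>L h n = h n" by (auto intro!: blinfun_eqI)
    moreover have "l * (1 + s) * (\<Sum>i<n - m. U (n - 1 - (m + i)) * d (m + i)) \<le> l * (1 + s) * s"
      using s2 l0 s by (intro mult_left_mono) auto
    ultimately show ?thesis by simp
  qed
  moreover have "norm (h n - ?c n x) \<le> l * s" using m by (intro hk) auto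
  moreover have "l \<le> norm (?c n y) + norm (h n - ?c n y) + norm (h n - ?c n x)"
  proof -
    have "l \<le> norm (h n) + norm (h n - ?c n x)"
      using norm_triangle_ineq4[of "h n" "h n - ?c n x"] by (simp add: l_def)
    moreover have "norm (h n) \<le> norm (?c n y) + norm (h n - ?c n y)" by (rule norm_triangle_sub)
    ultimately show ?thesis by linarith
  qed
  moreover have "l * (1 + s) * s + l * s \<le> l / 2"
  proof -
    \<comment> \<open>For s = 1/5 the total relative error is 11/25, below one half.\<close>
    have "(1 + s) * s + s \<le> (1 + 1/5) * (1/5) + 1/5" using s by (intro add_mono mult_mono) auto
    then have "l * ((1 + s) * s + s) \<le> l * (1/2)" using l0 by (intro mult_left_mono) auto
    then show ?thesis by (simp add: algebra_simps)
  qed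
  ultimately show ?thesis unfolding l_def[symmetric] by linarith
qed

section \<open>Robust segments of fast growth\<close>

lemma sum_exp_decay_le:
  assumes "\<kappa> > 0"
  shows "(\<Sum>i<n. exp (- \<kappa> * real i)) \<le> 1 / (1 - exp (- \<kappa>))"
proof -
  have "(\<Sum>i<n. exp (- \<kappa> * real i)) = (\<Sum>i<n. exp (- \<kappa>) ^ i)"
    by (simp add: exp_of_nat_mult[symmetric] mult.commute)
  also have "\<dots> = (1 - exp (- \<kappa>) ^ n) / (1 - exp (- \<kappa>))"
    using assms by (subst sum_gp_strict) auto
  also have "\<dots> \<le> 1 / (1 - exp (- \<kappa>))"
    using assms by (intro divide_right_mono) auto
  finally show ?thesis .
qed

text \<open>Starting from a long orbit segment with nearly maximal growth, one passes to the subsegment on which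
  the norm of the cocycle, normalised by the rate b, is largest among all subsegments. All its
  subsegments are then dominated, as the perturbation lemma requires.\<close>

lemma high_growth_segments:
  fixes B :: "'a::metric_space \<Rightarrow> 'v::real_normed_vector \<Rightarrow>\<^sub>L 'v"
  assumes \<alpha>: "\<alpha> > 0" and H: "\<And>x y. norm (B x - B y) \<le> H * dist x y powr \<alpha>" and lam: "lam > 0"
    and upper: "\<And>\<epsilon>. \<epsilon> > 0 \<Longrightarrow> \<exists>C. \<forall>n x. norm (op_cocycle B f n x) \<le> C * exp ((\<beta> + \<epsilon>) * real n)"
    and attained: "\<And>n. n \<ge> 1 \<Longrightarrow> \<exists>x. exp (\<beta> * real n) \<le> norm (op_cocycle B f n x)"
    and b: "b < \<beta>" "\<beta> - b \<le> lam * \<alpha> / 4"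
  obtains \<delta> where "\<delta> > 0" "\<And>n0. \<exists>n\<ge>n0. \<exists>x. \<forall>y.
    (\<forall>i\<le>n. dist ((f ^^ i) x) ((f ^^ i) y) \<le> \<delta> * exp (- lam * real (min i (n - i)))) \<longrightarrow>
      exp (b * real n) / 2 \<le> norm (op_cocycle B f n y)"
proof -
  define e where "e = \<beta> - b"
  \<comment> \<open>Half of the Hoelder decay rate lam * \<alpha> pays for the growth rate 2 * e;
    the other half, \<kappa>, keeps the errors summable.\<close>
  have e: "e > 0" "2 * e \<le> lam * \<alpha> / 2" using b by (auto simp: e_def)
  define \<kappa> where "\<kappa> = lam * \<alpha> / 2"
  have \<kappa>: "\<kappa> > 0" using lam \<alpha> by (simp add: \<kappa>_def)
  obtain C0 where C0: "\<And>n x. norm (op_cocycle B f n x) \<le> C0 * exp ((\<beta> + e) * real n)"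
    using upper[OF e(1)] by blast
  define C where "C = max C0 1"
  have C: "C \<ge> 1" "norm (op_cocycle B f n x) \<le> C * exp ((\<beta> + e) * real n)" for n x
    using order_trans[OF C0 mult_right_mono[of C0 C]] by (auto simp: C_def)
  \<comment> \<open>The normalisation moves rate b to 0: the long segment grows at rate e, and every
    product at rate at most 2 * e up to the factor C.\<close>
  define B' where "B' z = exp (- b) *\<^sub>R B z" for z
  let ?c = "op_cocycle B' f"
  have c: "norm (?c n x) = exp (- b * real n) * norm (op_cocycle B f n x)" for n x
    unfolding B'_def op_cocycle_scaleR by (simp add: exp_of_nat_mult[symmetric] mult.commute)
  have U: "norm (?c n x) \<le> C * exp (2 * e * real n)" for n x
  proof -
    have "norm (?c n x) \<le> exp (- b * real n) * (C * exp ((\<beta> + e) * real n))"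
      unfolding c by (intro mult_left_mono C) auto
    also have "\<dots> = C * exp (2 * e * real n)"
      by (simp add: exp_add[symmetric] e_def algebra_simps)
    finally show ?thesis .
  qed
  define q where "q = 1 / (1 - exp (- \<kappa>))"
  have q: "q > 0" using \<kappa> by (simp add: q_def)
  define H' where "H' = \<bar>H\<bar> * exp (- b) + 1"
  have H': "H' > 0" by (simp add: H'_def add_nonneg_pos)
  have B'H: "norm (B' x - B' y) \<le> H' * dist x y powr \<alpha>" for x y
  proof -
    have "norm (B' x - B' y) = exp (- b) * norm (B x - B y)"
      by (simp add: B'_def scaleR_diff_right[symmetric])
    also have "\<dots> \<le> exp (- b) * (\<bar>H\<bar> * dist x y powr \<alpha>)"
      by (intro mult_left_mono order_trans[OF H] mult_right_mono) auto
    also have "\<dots> \<le> H' * dist x y powr \<alpha>"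
      by (simp add: H'_def algebra_simps)
    finally show ?thesis .
  qed
  define \<delta> where "\<delta> = (1 / (5 * H' * C * q)) powr (1 / \<alpha>)"
  have \<delta>: "\<delta> > 0" "\<delta> powr \<alpha> = 1 / (5 * H' * C * q)"
    using H' C q \<alpha> by (auto simp: \<delta>_def powr_powr)
  show thesis
  proof
    show "\<delta> > 0" by fact
    fix n0 :: nat
    \<comment> \<open>A segment shorter than n0 has normalised norm at most C * exp (2 * e * n0); N
      is so large that the maximal norm, at least exp (e * N), exceeds this.\<close>
    obtain N :: nat where N: "real N > (ln C + 2 * e * real n0) / e" "N \<ge> 1"
      by (metis reals_Archimedean2 less_le_trans of_nat_mono max.cobounded1 max.cobounded2)
    obtain z where z: "exp (\<beta> * real N) \<le> norm (op_cocycle B f N z)" using attained N by blast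
    define S where "S = {(i, k). i + k \<le> N}"
    have "finite S" by (rule finite_subset[of _ "{..N} \<times> {..N}"]) (auto simp: S_def)
    have "(0, N) \<in> S" by (simp add: S_def)
    define g where "g s = norm (?c (snd s) ((f ^^ fst s) z))" for s
    have "Max (g ` S) \<in> g ` S" using \<open>finite S\<close> \<open>(0, N) \<in> S\<close> by (intro Max_in) auto
    then obtain s where s: "Max (g ` S) = g s" "s \<in> S" by (elim imageE)
    obtain p n where pn': "s = (p, n)" by (cases s)
    then have pn: "(p, n) \<in> S" using s by simp
    have max: "norm (?c k ((f ^^ i) z)) \<le> norm (?c n ((f ^^ p) z))" if "(i, k) \<in> S" for i k
    proof -
      have "g (i, k) \<le> Max (g ` S)" using \<open>finite S\<close> that by (intro Max_ge) auto
      then show ?thesis unfolding s(1) by (simp add: g_def pn')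
    qed
    define x where "x = (f ^^ p) z"
    have L: "norm (?c k ((f ^^ i) x)) \<le> norm (?c n x)" if "i + k \<le> n" for i k
    proof -
      have "(f ^^ i) x = (f ^^ (p + i)) z" by (simp add: x_def funpow_add add.commute[of p])
      moreover have "(p + i, k) \<in> S" using pn that by (simp add: S_def)
      ultimately show ?thesis using max[of "p + i" k] by (simp add: x_def)
    qed
    have big: "exp (e * real N) \<le> norm (?c n x)"
    proof -
      have "exp (e * real N) = exp (- b * real N) * exp (\<beta> * real N)"
        by (simp add: exp_add[symmetric] e_def algebra_simps)
      also have "\<dots> \<le> norm (?c N z)" unfolding c by (intro mult_left_mono z) auto
      also have "\<dots> \<le> norm (?c n x)" using max[of 0 N] by (simp add: S_def x_def)
      finally show ?thesis .
    qed
    have "n \<ge> n0"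
    proof (rule ccontr)
      assume "\<not> n \<ge> n0"
      then have "C * exp (2 * e * real n) \<le> C * exp (2 * e * real n0)"
        using C(1) e by (intro mult_left_mono) auto
      then have "exp (e * real N) \<le> C * exp (2 * e * real n0)"
        using big U[of n x] by linarith
      also have "\<dots> = exp (ln C + 2 * e * real n0)" using C(1) by (simp add: exp_add)
      finally have "e * real N \<le> ln C + 2 * e * real n0" by simp
      then show False using N(1) e(1) by (simp add: pos_divide_less_eq mult.commute)
    qed
    moreover have "exp (b * real n) / 2 \<le> norm (op_cocycle B f n y)"
      if y: "\<forall>i\<le>n. dist ((f ^^ i) x) ((f ^^ i) y) \<le> \<delta> * exp (- lam * real (min i (n - i)))" for y
    proof -
      define d where "d i = 1 / (5 * C * q) * exp (- 2 * \<kappa> * real (min i (n - i)))" for i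
      have dle: "norm (B' ((f ^^ i) y) - B' ((f ^^ i) x)) \<le> d i" if "i < n" for i
      proof -
        have "norm (B' ((f ^^ i) y) - B' ((f ^^ i) x)) \<le> H' * dist ((f ^^ i) x) ((f ^^ i) y) powr \<alpha>"
          by (subst dist_commute) (rule B'H)
        also have "\<dots> \<le> H' * (\<delta> * exp (- lam * real (min i (n - i)))) powr \<alpha>"
          using H' \<alpha> y that by (intro mult_left_mono powr_mono2) auto
        also have "\<dots> = H' * (\<delta> powr \<alpha>) * exp (- lam * real (min i (n - i))) powr \<alpha>"
          using \<delta>(1) by (simp add: powr_mult)
        also have "\<dots> = d i"
          unfolding \<delta>(2) d_def \<kappa>_def using H' by (simp add: exp_powr_real mult.commute mult.left_commute)
        finally show ?thesis .
      qed
      have decay: "d i * (C * exp (2 * e * real j)) \<le> 1 / (5 * q) * exp (- \<kappa> * real j)"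
        if "j \<le> min i (n - i)" for i j
      proof -
        have "2 * e * real j - 2 * \<kappa> * real (min i (n - i)) \<le> \<kappa> * real j - 2 * \<kappa> * real j"
          using e(2) \<kappa> that by (intro diff_mono mult_right_mono mult_left_mono) (auto simp: \<kappa>_def)
        then have "2 * e * real j - 2 * \<kappa> * real (min i (n - i)) \<le> - \<kappa> * real j" by simp
        then have "exp (2 * e * real j - 2 * \<kappa> * real (min i (n - i))) \<le> exp (- \<kappa> * real j)"
          by (simp only: exp_le_cancel_iff)
        then have "1 / (5 * q) * exp (2 * e * real j - 2 * \<kappa> * real (min i (n - i))) \<le> 1 / (5 * q) * exp (- \<kappa> * real j)"
          using q by (intro mult_left_mono) auto
        moreover have "d i * (C * exp (2 * e * real j)) = 1 / (5 * q) * exp (2 * e * real j - 2 * \<kappa> * real (min i (n - i)))"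
          using C(1) q unfolding d_def exp_diff exp_minus by (simp add: field_simps exp_minus)
        ultimately show ?thesis by simp
      qed
      have tot: "(\<Sum>i<k. 1 / (5 * q) * exp (- \<kappa> * real i)) \<le> 1 / 5" for k
      proof -
        have "(\<Sum>i<k. 1 / (5 * q) * exp (- \<kappa> * real i)) = 1 / (5 * q) * (\<Sum>i<k. exp (- \<kappa> * real i))"
          by (simp add: sum_distrib_left)
        also have "\<dots> \<le> 1 / (5 * q) * q"
          using sum_exp_decay_le[OF \<kappa>] q by (intro mult_left_mono) (auto simp: q_def)
        finally show ?thesis using q by simp
      qed
      define m where "m = n div 2"
      have "norm (?c n x) / 2 \<le> norm (?c n y)"
      proof (rule op_cocycle_perturbation[where d = d and U = "\<lambda>k. C * exp (2 * e * real k)" and m = m and s = "1 / 5"])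
        show "(\<Sum>i<m. d i * (C * exp (2 * e * real i))) \<le> 1 / 5"
          by (rule order_trans[OF sum_mono tot[of m]], rule decay) (auto simp: m_def)
        have "(\<Sum>i<n - m. C * exp (2 * e * real (n - 1 - (m + i))) * d (m + i))
            \<le> (\<Sum>i<n - m. 1 / (5 * q) * exp (- \<kappa> * real (n - m - Suc i)))"
        proof (rule sum_mono)
          fix i assume "i \<in> {..<n - m}"
          then have "n - m - Suc i \<le> min (m + i) (n - (m + i))" by (auto simp: m_def)
          from decay[OF this] show "C * exp (2 * e * real (n - 1 - (m + i))) * d (m + i)
            \<le> 1 / (5 * q) * exp (- \<kappa> * real (n - m - Suc i))" by (simp add: mult_ac)
        qed
        also have "\<dots> = (\<Sum>i<n - m. 1 / (5 * q) * exp (- \<kappa> * real i))"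
          by (rule sum.nat_diff_reindex)
        finally show "(\<Sum>i<n - m. C * exp (2 * e * real (n - 1 - (m + i))) * d (m + i)) \<le> 1 / 5"
          using tot[of "n - m"] by linarith
      qed (use dle L U in \<open>auto simp: m_def\<close>)
      moreover have "1 \<le> norm (?c n x)"
        using big e(1) by (intro order_trans[OF _ big]) simp
      ultimately have "1 / 2 \<le> norm (?c n y)" by linarith
      then have "1 / 2 \<le> exp (- b * real n) * norm (op_cocycle B f n y)" unfolding c .
      then have "exp (b * real n) * (1 / 2) \<le> exp (b * real n) * (exp (- b * real n) * norm (op_cocycle B f n y))"
        by (intro mult_left_mono) auto
      also have "\<dots> = norm (op_cocycle B f n y)"
        unfolding mult.assoc[symmetric] exp_add[symmetric] by simp
      finally show ?thesis by simp
    qed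
    ultimately show "\<exists>n\<ge>n0. \<exists>x. \<forall>y.
      (\<forall>i\<le>n. dist ((f ^^ i) x) ((f ^^ i) y) \<le> \<delta> * exp (- lam * real (min i (n - i)))) \<longrightarrow>
      exp (b * real n) / 2 \<le> norm (op_cocycle B f n y)" by blast
  qed
qed

section \<open>Hoelder cocycles of invertible operators\<close>

locale linear_cocycle =
  fixes f :: "'a::metric_space \<Rightarrow> 'a" and B :: "'a \<Rightarrow> 'v::euclidean_space \<Rightarrow>\<^sub>L 'v" and H \<alpha> :: real
  assumes compact_UNIV: "compact (UNIV :: 'a set)"
    and continuous_f: "continuous_on UNIV f"
    and \<alpha>_pos: "\<alpha> > 0"
    and hoelder: "norm (B x - B y) \<le> H * dist x y powr \<alpha>"
    and bij_B: "bij (blinfun_apply (B x))"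
begin

lemma continuous_B: "continuous_on UNIV B"
  unfolding continuous_on_iff
proof (intro ballI allI impI)
  fix x :: 'a and e :: real assume e: "e > 0"
  define r where "r = e / (\<bar>H\<bar> + 1)"
  have r: "r > 0" using e by (simp add: r_def add_nonneg_pos)
  show "\<exists>d>0. \<forall>y\<in>UNIV. dist y x < d \<longrightarrow> dist (B y) (B x) < e"
  proof (intro exI[of _ "r powr (1 / \<alpha>)"] conjI ballI impI)
    fix y assume "dist y x < r powr (1 / \<alpha>)"
    then have "dist y x powr \<alpha> < (r powr (1 / \<alpha>)) powr \<alpha>"
      using \<alpha>_pos by (intro powr_less_mono2) auto
    then have lt: "dist y x powr \<alpha> < r" using r \<alpha>_pos by (simp add: powr_powr)
    have "norm (B y - B x) \<le> (\<bar>H\<bar> + 1) * dist y x powr \<alpha>"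
      by (intro order_trans[OF hoelder] mult_right_mono) auto
    also have "\<dots> < (\<bar>H\<bar> + 1) * r" using lt by (intro mult_strict_left_mono) auto
    also have "\<dots> = e" by (simp add: r_def)
    finally show "dist (B y) (B x) < e" by (simp add: dist_norm)
  qed (use r in auto)
qed

lemma continuous_op_cocycle: "continuous_on UNIV (op_cocycle B f n)"
proof (induction n)
  case (Suc n)
  have "continuous_on UNIV (\<lambda>x. B ((f ^^ n) x))"
    by (rule continuous_on_compose2[OF continuous_B continuous_on_funpow[OF continuous_f]]) simp
  then have "continuous_on UNIV (\<lambda>x. B ((f ^^ n) x) o\<^sub>L op_cocycle B f n x)"
    using Suc by (rule bounded_bilinear.continuous_on[OF bounded_bilinear_blinfun_compose])
  then show ?case by simp
qed simp

text \<open>Compactness of the space times the unit sphere makes injectivity uniform.\<close>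

lemma norm_bounds:
  obtains m M where "0 < m" "m \<le> 1" "1 \<le> M" "\<And>x. norm (B x) \<le> M" "\<And>x v. m * norm v \<le> norm (B x v)"
proof -
  have "bounded (range B)"
    by (intro compact_imp_bounded compact_continuous_image continuous_B compact_UNIV)
  then obtain M where M: "\<And>x. norm (B x) \<le> M" unfolding bounded_iff by blast
  have "continuous_on (UNIV \<times> sphere 0 1) (\<lambda>p. norm (B (fst p) (snd p)))"
  proof (rule continuous_on_norm)
    have "continuous_on (UNIV \<times> sphere 0 1) (\<lambda>p :: 'a \<times> 'v. B (fst p))"
      by (rule continuous_on_compose2[OF continuous_B continuous_on_fst[OF continuous_on_id]]) simp
    then show "continuous_on (UNIV \<times> sphere 0 1) (\<lambda>p. B (fst p) (snd p))"
      by (rule bounded_bilinear.continuous_on[OF bounded_bilinear_blinfun_apply _ continuous_on_snd[OF continuous_on_id]])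
  qed
  moreover have "compact ((UNIV :: 'a set) \<times> sphere (0 :: 'v) 1)"
    by (intro compact_Times compact_UNIV compact_sphere)
  moreover have "(UNIV :: 'a set) \<times> sphere (0 :: 'v) 1 \<noteq> {}"
    by (simp add: Times_eq_image_sum)
  ultimately have "\<exists>p\<in>UNIV \<times> sphere 0 1. \<forall>q\<in>UNIV \<times> sphere 0 1. norm (B (fst p) (snd p)) \<le> norm (B (fst q) (snd q))"
    by (intro continuous_attains_inf)
  then obtain p where p: "p \<in> UNIV \<times> sphere 0 1"
    and min: "\<And>q. q \<in> UNIV \<times> sphere 0 1 \<Longrightarrow> norm (B (fst p) (snd p)) \<le> norm (B (fst q) (snd q))" by blast
  define m where "m = min 1 (norm (B (fst p) (snd p)))"
  have "snd p \<noteq> 0" using p by auto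
  then have "B (fst p) (snd p) \<noteq> 0"
    using bij_B[of "fst p"] by (metis bij_def blinfun.zero_right injD)
  then have m0: "m > 0" by (simp add: m_def)
  have "m * norm v \<le> norm (B x v)" for x v
  proof (cases "v = 0")
    case False
    have "m \<le> norm (B x (v /\<^sub>R norm v))"
      using min[of "(x, v /\<^sub>R norm v)"] False by (auto simp: m_def)
    then show ?thesis using False by (simp add: blinfun.scaleR_right field_simps)
  qed simp
  moreover have "norm (B x) \<le> max 1 M" for x using M[of x] by simp
  ultimately show thesis using that[of m "max 1 M"] m0 by (auto simp: m_def)
qed

definition \<phi> :: "nat \<Rightarrow> 'a \<Rightarrow> real" where
  "\<phi> n x = ln (norm (op_cocycle B f n x))"

lemma op_cocycle_norm_pos: "norm (op_cocycle B f n x) > 0"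
proof -
  obtain m M where m: "0 < m" "\<And>x v. m * norm v \<le> norm (B x v)" by (rule norm_bounds) blast
  obtain v :: 'v where "v \<noteq> 0" using nonzero_Basis nonempty_Basis by blast
  have "op_cocycle B f n x v \<noteq> 0"
  proof (induction n)
    case (Suc n)
    then have "0 < m * norm (op_cocycle B f n x v)" using m by simp
    then show ?case using m(2)[of "op_cocycle B f n x v" "(f ^^ n) x"] by auto
  qed (use \<open>v \<noteq> 0\<close> in simp)
  then show ?thesis by auto
qed

lemma norm_op_cocycle_eq_exp: "norm (op_cocycle B f n x) = exp (\<phi> n x)"
  using op_cocycle_norm_pos by (simp add: \<phi>_def)

lemma bounded_subadditive: obtains K where "bounded_subadditive_cocycle f \<phi> K"
proof -
  obtain m M where m: "0 < m" "m \<le> 1" "1 \<le> M" and M: "\<And>x. norm (B x) \<le> M"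
    and lower: "\<And>x v. m * norm v \<le> norm (B x v)" by (rule norm_bounds) blast
  \<comment> \<open>Since m \<le> 1 \<le> M, one constant bounds both the gain ln M and the loss -
    ln m of a step.\<close>
  define K where "K = ln M - ln m"
  have K: "ln M \<le> K" "- ln m \<le> K" using m by (auto simp: K_def)
  have pos: "norm (op_cocycle B f n x) > 0" for n x by (rule op_cocycle_norm_pos)
  have "bounded_subadditive_cocycle f \<phi> K"
  proof
    show "continuous_on UNIV (\<phi> n)" for n
      unfolding \<phi>_def[abs_def] using op_cocycle_norm_pos
      by (intro continuous_on_ln continuous_on_norm continuous_op_cocycle) auto
    show "\<phi> (k + n) x \<le> \<phi> k x + \<phi> n ((f ^^ k) x)" for k n x
    proof -
      have "norm (op_cocycle B f (k + n) x) \<le> norm (op_cocycle B f n ((f ^^ k) x)) * norm (op_cocycle B f k x)"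
        unfolding op_cocycle_add by (rule norm_blinfun_compose)
      then have "exp (\<phi> (k + n) x) \<le> exp (\<phi> n ((f ^^ k) x) + \<phi> k x)"
        by (simp add: norm_op_cocycle_eq_exp exp_add)
      then show ?thesis by simp
    qed
    have up: "\<phi> (Suc n) x \<le> \<phi> n x + ln M" for n x
    proof -
      have "norm (op_cocycle B f (Suc n) x) \<le> M * norm (op_cocycle B f n x)"
        using order_trans[OF norm_blinfun_compose mult_right_mono[OF M]] by simp
      then have "exp (\<phi> (Suc n) x) \<le> exp (\<phi> n x + ln M)"
        using m unfolding norm_op_cocycle_eq_exp exp_add by (simp add: mult.commute)
      then show ?thesis by simp
    qed
    have lo: "\<phi> n x \<le> \<phi> (Suc n) x - ln m" for n x
    proof -
      have "norm (op_cocycle B f n x) \<le> norm (op_cocycle B f (Suc n) x) / m"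
      proof (rule norm_blinfun_bound)
        fix v
        have "m * norm (op_cocycle B f n x v) \<le> norm (op_cocycle B f (Suc n) x v)"
          using lower by simp
        also have "\<dots> \<le> norm (op_cocycle B f (Suc n) x) * norm v" by (rule norm_blinfun)
        finally show "norm (op_cocycle B f n x v) \<le> norm (op_cocycle B f (Suc n) x) / m * norm v"
          using m by (simp add: field_simps)
      qed (use m in auto)
      then have "exp (\<phi> n x) \<le> exp (\<phi> (Suc n) x - ln m)"
        using m unfolding norm_op_cocycle_eq_exp exp_diff by simp
      then show ?thesis by simp
    qed
    have \<phi>0: "\<phi> 0 x = 0" for x by (simp add: \<phi>_def)
    show "\<bar>\<phi> n x\<bar> \<le> K * real n" for n x
    proof (induction n)
      case (Suc n)
      then have "- (K * real n) \<le> \<phi> n x" "\<phi> n x \<le> K * real n" by linarith+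
      then have "- (K * real n) - K \<le> \<phi> (Suc n) x" "\<phi> (Suc n) x \<le> K * real n + K"
        using up[of n x] lo[of n x] K by linarith+
      then show ?case by (simp add: abs_le_iff algebra_simps)
    qed (simp add: \<phi>0)
    show "\<phi> n (f x) \<le> \<phi> (Suc n) x + K" for n x
    proof -
      have "norm (op_cocycle B f n (f x)) \<le> norm (op_cocycle B f (Suc n) x) / m"
      proof (rule norm_blinfun_bound)
        fix w
        \<comment> \<open>Surjectivity presents w as the image of a v with norm at most norm w / m,
          which restores the deleted first factor.\<close>
        obtain v where v: "w = B x v" using bij_B[of x] by (metis bij_pointE)
        have "norm (op_cocycle B f n (f x) w) = norm (op_cocycle B f (Suc n) x v)"
          unfolding op_cocycle_Suc_right v by simp
        also have "\<dots> \<le> norm (op_cocycle B f (Suc n) x) * norm v" by (rule norm_blinfun)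
        also have "\<dots> \<le> norm (op_cocycle B f (Suc n) x) * (norm w / m)"
          using lower[of v x] m v by (intro mult_left_mono) (auto simp: field_simps)
        finally show "norm (op_cocycle B f n (f x) w) \<le> norm (op_cocycle B f (Suc n) x) / m * norm w" by simp
      qed (use m in auto)
      then have "exp (\<phi> n (f x)) \<le> exp (\<phi> (Suc n) x - ln m)"
        using m unfolding norm_op_cocycle_eq_exp exp_diff by simp
      then show ?thesis using K by simp
    qed
  qed (rule compact_UNIV continuous_f)+
  then show thesis by (rule that)
qed

end

text \<open>The norm of a matrix is the Euclidean norm of its entries. In finite dimension the
  linear passage to operators is bounded, which affects only the Hoelder constant.\<close>

lemma linear_cocycle_of_matrices:
  fixes f :: "'a::metric_space \<Rightarrow> 'a" and A :: "'a \<Rightarrow> real^'m^'m"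
  assumes "compact (UNIV :: 'a set)" "continuous_on UNIV f" "\<alpha> > 0" "\<And>x. invertible (A x)"
    and C: "\<And>x y. norm (A x - A y) \<le> C * dist x y powr \<alpha>"
  obtains B :: "'a \<Rightarrow> (real^'m) \<Rightarrow>\<^sub>L (real^'m)" and H
  where "linear_cocycle f B H \<alpha>" "\<And>n x. norm (op_cocycle B f n x) = opnorm (cocycle A f n x)"
proof -
  define T where "T M = Blinfun (\<lambda>v. M *v v)" for M :: "real^'m^'m"
  have T: "blinfun_apply (T M) v = M *v v" for M v
    unfolding T_def by (subst bounded_linear_Blinfun_apply) (auto intro: matrix_vector_mul_bounded_linear)
  have "linear T"
    by (rule linearI) (auto intro!: blinfun_eqI simp: T blinfun.add_left blinfun.scaleR_left
        matrix_vector_mult_add_rdistrib scaleR_matrix_vector_assoc)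
  then obtain b where b: "\<And>M. norm (T M) \<le> b * norm M" using linear_bounded by blast
  have Tdiff: "T (M - N) = T M - T N" for M N using \<open>linear T\<close> by (rule linear_diff)
  have H: "norm (T (A x) - T (A y)) \<le> (\<bar>b\<bar> * \<bar>C\<bar>) * dist x y powr \<alpha>" for x y
  proof -
    have "norm (T (A x) - T (A y)) \<le> b * norm (A x - A y)" unfolding Tdiff[symmetric] by (rule b)
    also have "\<dots> \<le> \<bar>b\<bar> * norm (A x - A y)" by (intro mult_right_mono) auto
    also have "\<dots> \<le> \<bar>b\<bar> * (\<bar>C\<bar> * dist x y powr \<alpha>)"
      by (intro mult_left_mono order_trans[OF C] mult_right_mono) auto
    finally show ?thesis by (simp add: mult.assoc)
  qed
  have "bij (blinfun_apply (T (A x)))" for x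
  proof -
    have "blinfun_apply (T (A x)) = (\<lambda>v. A x *v v)" using T by blast
    then show ?thesis using assms(4)[of x] by (simp add: invertible_eq_bij)
  qed
  then have "linear_cocycle f (\<lambda>x. T (A x)) (\<bar>b\<bar> * \<bar>C\<bar>) \<alpha>"
    using assms H by unfold_locales auto
  moreover have "norm (op_cocycle (\<lambda>x. T (A x)) f n x) = opnorm (cocycle A f n x)" for n x
  proof -
    have "blinfun_apply (op_cocycle (\<lambda>x. T (A x)) f n x) v = cocycle A f n x *v v" for v
      by (induction n) (auto simp: T matrix_vector_mul_assoc)
    then have "blinfun_apply (op_cocycle (\<lambda>x. T (A x)) f n x) = (\<lambda>v. cocycle A f n x *v v)" by blast
    then show ?thesis by (simp add: norm_blinfun.rep_eq opnorm_def)
  qed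
  ultimately show thesis by (rule that)
qed

section \<open>Irregular points and distributional chaos\<close>

lemma not_convergent_if_two_limits:
  fixes X :: "nat \<Rightarrow> real"
  assumes "filterlim r at_top sequentially" "filterlim s at_top sequentially"
    and "\<And>c. c \<ge> 1 \<Longrightarrow> b - D / real c \<le> X (r c)" "\<And>c. c \<ge> 1 \<Longrightarrow> X (s c) \<le> a + D / real c"
    and "a < b"
  shows "\<not> convergent X"
proof
  assume "convergent X"
  then obtain l where l: "X \<longlonglongrightarrow> l" by (auto simp: convergent_def)
  have D: "(\<lambda>c. D / real c) \<longlonglongrightarrow> 0" by (rule lim_const_over_n)
  have "b - 0 \<le> l"
  proof (rule LIMSEQ_le)
    show "(\<lambda>c. b - D / real c) \<longlonglongrightarrow> b - 0" by (intro tendsto_intros D)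
    show "(\<lambda>c. X (r c)) \<longlonglongrightarrow> l" using filterlim_compose[OF l assms(1)] .
  qed (use assms(3) in blast)
  moreover have "l \<le> a + 0"
  proof (rule LIMSEQ_le)
    show "(\<lambda>c. a + D / real c) \<longlonglongrightarrow> a + 0" by (intro tendsto_intros D)
    show "(\<lambda>c. X (s c)) \<longlonglongrightarrow> l" using filterlim_compose[OF l assms(2)] .
  qed (use assms(4) in blast)
  ultimately show False using assms(5) by simp
qed

lemma limsup_eq_1I:
  fixes X :: "nat \<Rightarrow> real"
  assumes "\<And>n. X n \<le> 1" "\<And>e m. e > 0 \<Longrightarrow> \<exists>n\<ge>m. 1 - e \<le> X n"
  shows "limsup (\<lambda>n. ereal (X n)) = 1"
proof (rule antisym)
  show "limsup (\<lambda>n. ereal (X n)) \<le> 1" using assms(1) by (intro Limsup_bounded) auto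
  show "1 \<le> limsup (\<lambda>n. ereal (X n))"
  proof (rule ccontr)
    assume "\<not> ?thesis"
    then obtain c where c: "limsup (\<lambda>n. ereal (X n)) < ereal c" "c < 1"
      using ereal_dense2[of "limsup (\<lambda>n. ereal (X n))" 1] by (auto simp: not_le one_ereal_def)
    then have "eventually (\<lambda>n. ereal (X n) < ereal c) sequentially" by (intro Limsup_lessD)
    then obtain m where "\<And>n. n \<ge> m \<Longrightarrow> X n < c" by (auto simp: eventually_sequentially)
    then show False using assms(2)[of "1 - c" m] c(2) by force
  qed
qed

lemma liminf_eq_0I:
  fixes X :: "nat \<Rightarrow> real"
  assumes "\<And>n. 0 \<le> X n" "\<And>e m. e > 0 \<Longrightarrow> \<exists>n\<ge>m. X n \<le> e"
  shows "liminf (\<lambda>n. ereal (X n)) = 0"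
proof (rule antisym)
  show "0 \<le> liminf (\<lambda>n. ereal (X n))" using assms(1) by (intro Liminf_bounded) auto
  show "liminf (\<lambda>n. ereal (X n)) \<le> 0"
  proof (rule ccontr)
    assume "\<not> ?thesis"
    then obtain c where c: "ereal c < liminf (\<lambda>n. ereal (X n))" "0 < c"
      using ereal_dense2[of 0 "liminf (\<lambda>n. ereal (X n))"] by (auto simp: not_le zero_ereal_def)
    then have "eventually (\<lambda>n. ereal c < ereal (X n)) sequentially" by (intro less_LiminfD)
    then obtain m where "\<And>n. n \<ge> m \<Longrightarrow> c < X n" by (auto simp: eventually_sequentially)
    then show False using assms(2)[of c m] c(2) by force
  qed
qed

lemma uncountable_nat_bool: "uncountable (UNIV :: (nat \<Rightarrow> bool) set)"
proof
  assume c: "countable (UNIV :: (nat \<Rightarrow> bool) set)"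
  define g where "g = from_nat_into (UNIV :: (nat \<Rightarrow> bool) set)"
  obtain k where "g k = (\<lambda>n. \<not> g n n)"
    using from_nat_into_surj[OF c, of "\<lambda>n. \<not> g n n"] by (auto simp: g_def)
  then have "g k k = (\<not> g k k)" by (rule fun_cong)
  then show False by simp
qed

text \<open>By \<open>len\<close>, block k fills all but a fraction 1 / k of the times before its
  end, so the frequencies read off at that end are those of the block.\<close>

lemma DC1_pair_of_blocks:
  fixes f :: "'a::metric_space \<Rightarrow> 'a"
  assumes len: "\<And>k. k * Suc (Ns k) \<le> Ms k" and t: "t > 0"
    and near: "\<And>e c0. e > 0 \<Longrightarrow> \<exists>k\<ge>c0. \<forall>i. Ns k \<le> i \<longrightarrow> i \<le> Ns k + Ms k \<longrightarrow> dist ((f ^^ i) x) ((f ^^ i) y) < e"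
    and far: "\<And>c0. \<exists>k\<ge>c0. \<forall>i. Ns k \<le> i \<longrightarrow> i \<le> Ns k + Ms k \<longrightarrow> t \<le> dist ((f ^^ i) x) ((f ^^ i) y)"
  shows "DC1_pair f x y"
proof -
  define X where "X s n = real (card {i\<in>{0..<n}. dist ((f ^^ i) x) ((f ^^ i) y) < s}) / real n" for s and n :: nat
  have cardle: "card {i\<in>{0..<n}. P i} \<le> n" for n P
    by (rule order_trans[OF card_mono[of "{0..<n}"]]) auto
  have X01: "0 \<le> X s n" "X s n \<le> 1" for s n
    using cardle[of n] by (auto simp: X_def divide_le_eq_1)
  define T where "T k = Ns k + Ms k" for k
  have T: "k \<le> T k" "real (Ns k) / real (T k) \<le> 1 / real k" if "k \<ge> 1" for k
  proof -
    have "k * Suc (Ns k) \<le> T k" using len[of k] by (simp add: T_def)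
    then have 1: "real k + real k * real (Ns k) \<le> real (T k)"
      by (metis mult_Suc_right of_nat_add of_nat_mult of_nat_mono)
    then have "real k \<le> real (T k)" using mult_nonneg_nonneg[of "real k" "real (Ns k)"] by linarith
    then show "k \<le> T k" by simp
    then have "0 < real (T k)" using that by linarith
    moreover have "real k * real (Ns k) \<le> real (T k)" using 1 by linarith
    ultimately show "real (Ns k) / real (T k) \<le> 1 / real k"
      using that by (simp add: field_simps)
  qed
  have "limsup (\<lambda>n. ereal (X s n)) = 1" if s: "s > 0" for s
  proof (rule limsup_eq_1I[OF X01(2)])
    fix e :: real and m :: nat assume e: "e > 0"
    obtain M :: nat where M: "real M > 1 / e" using reals_Archimedean2 by blast
    obtain k where k: "k \<ge> max (max M m) 1"
      "\<And>i. Ns k \<le> i \<Longrightarrow> i \<le> T k \<Longrightarrow> dist ((f ^^ i) x) ((f ^^ i) y) < s"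
      using near[OF s, of "max (max M m) 1"] by (auto simp: T_def)
    have k1: "k \<ge> 1" using k by simp
    have "{Ns k..<T k} \<subseteq> {i\<in>{0..<T k}. dist ((f ^^ i) x) ((f ^^ i) y) < s}" using k(2) by auto
    then have "card {Ns k..<T k} \<le> card {i\<in>{0..<T k}. dist ((f ^^ i) x) ((f ^^ i) y) < s}"
      by (intro card_mono) auto
    then have "real (T k) - real (Ns k) \<le> real (card {i\<in>{0..<T k}. dist ((f ^^ i) x) ((f ^^ i) y) < s})"
      by (simp add: T_def)
    then have "(real (T k) - real (Ns k)) / real (T k) \<le> X s (T k)"
      unfolding X_def by (intro divide_right_mono) auto
    moreover have "(real (T k) - real (Ns k)) / real (T k) = 1 - real (Ns k) / real (T k)"
      using T(1)[OF k1] k1 by (simp add: diff_divide_distrib)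
    moreover have "1 / real k \<le> e"
    proof -
      have "1 / e < real k" using M k(1) by linarith
      then show ?thesis using e k1 by (simp add: field_simps)
    qed
    ultimately have "1 - e \<le> X s (T k)" using T(2)[OF k1] by linarith
    moreover have "T k \<ge> m" using T(1)[OF k1] k(1) by simp
    ultimately show "\<exists>n\<ge>m. 1 - e \<le> X s n" by blast
  qed
  moreover have "liminf (\<lambda>n. ereal (X t n)) = 0"
  proof (rule liminf_eq_0I[OF X01(1)])
    fix e :: real and m :: nat assume e: "e > 0"
    obtain M :: nat where M: "real M > 1 / e" using reals_Archimedean2 by blast
    obtain k where k: "k \<ge> max (max M m) 1"
      "\<And>i. Ns k \<le> i \<Longrightarrow> i \<le> T k \<Longrightarrow> t \<le> dist ((f ^^ i) x) ((f ^^ i) y)"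
      using far[of "max (max M m) 1"] by (auto simp: T_def)
    have k1: "k \<ge> 1" using k by simp
    have "{i\<in>{0..<T k}. dist ((f ^^ i) x) ((f ^^ i) y) < t} \<subseteq> {0..<Ns k}"
      using k(2) by (force simp: not_le[symmetric])
    then have "card {i\<in>{0..<T k}. dist ((f ^^ i) x) ((f ^^ i) y) < t} \<le> card {0..<Ns k}"
      by (intro card_mono) auto
    then have "X t (T k) \<le> real (Ns k) / real (T k)"
      unfolding X_def by (intro divide_right_mono) auto
    moreover have "1 / real k \<le> e"
    proof -
      have "1 / e < real k" using M k(1) by linarith
      then show ?thesis using e k1 by (simp add: field_simps)
    qed
    ultimately have "X t (T k) \<le> e" using T(2)[OF k1] by linarith
    moreover have "T k \<ge> m" using T(1)[OF k1] k(1) by simp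
    ultimately show "\<exists>n\<ge>m. X t n \<le> e" by blast
  qed
  ultimately show ?thesis using t unfolding DC1_pair_def X_def by blast
qed

section \<open>Concatenation of blocks into irregular scrambled orbits\<close>

context bounded_subadditive_cocycle
begin

lemma tail_le_funpow: "\<phi> n ((f ^^ s) x) \<le> \<phi> (s + n) x + K * real s"
proof (induction s arbitrary: x)
  case (Suc s)
  have "\<phi> n ((f ^^ Suc s) x) \<le> \<phi> (s + n) (f x) + K * real s"
    using Suc[of "f x"] by (simp add: funpow_swap1)
  also have "\<phi> (s + n) (f x) \<le> \<phi> (Suc s + n) x + K" using tail_le[of "s + n" x] by simp
  finally show ?case by (simp add: algebra_simps)
qed simp

text \<open>Fast segments come in lengths that can be made large but not prescribed, so block
  lengths are determined along with the starting times. Neither depends on the bits; any two orbits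
  are thus compared over the same blocks.\<close>

lemma uncountable_irregular_scrambled_set:
  assumes lam: "lam > 0" and gap: "\<And>\<delta>. \<delta> > 0 \<Longrightarrow> \<exists>N. spec_gap f lam \<delta> N"
    and ab: "a < b" and \<delta>h: "\<delta>h > 0" and \<delta>l: "\<delta>l > 0"
    and high: "\<And>n0. \<exists>n\<ge>n0. \<exists>x. \<forall>y. (\<forall>i\<le>n. dist ((f ^^ i) x) ((f ^^ i) y) \<le> \<delta>h * exp (- lam * real (min i (n - i))))
       \<longrightarrow> b * real n - ch \<le> \<phi> n y"
    and low: "\<And>n. n \<ge> n1 \<Longrightarrow> \<exists>x. \<forall>y. (\<forall>i\<le>n. dist ((f ^^ i) x) ((f ^^ i) y) \<le> \<delta>l)
       \<longrightarrow> \<phi> n y \<le> a * real n + cl"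
  shows "\<exists>S. S \<subseteq> {x. \<not> convergent (\<lambda>n. \<phi> n x / real n)} \<and> uncountable S \<and> DC1_scrambled f S"
proof -
  \<comment> \<open>In a one-point space \<open>high\<close> and \<open>low\<close> bound the same
    number, contradicting a < b for long segments.\<close>
  have "\<exists>p q :: 'a. p \<noteq> q"
  proof (rule ccontr)
    assume "\<not> ?thesis"
    then have eq: "p = q" for p q :: 'a by blast
    obtain M :: nat where M: "real M > (cl + ch) / (b - a)" using reals_Archimedean2 by blast
    obtain n x where n: "n \<ge> max M n1" and x: "b * real n - ch \<le> \<phi> n x"
      using high[of "max M n1"] \<delta>h eq by (metis dist_self exp_ge_zero less_imp_le mult_nonneg_nonneg)
    obtain z where "\<phi> n z \<le> a * real n + cl" using low[of n] n \<delta>l eq by (metis dist_self less_imp_le max.boundedE)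
    then have "b * real n - ch \<le> a * real n + cl" using x eq[of x z] by simp
    moreover have "(cl + ch) / (b - a) < real n" using M n by linarith
    then have "cl + ch < (b - a) * real n" using ab by (simp add: field_simps)
    ultimately show False by (simp add: algebra_simps)
  qed
  then obtain p q :: 'a where "p \<noteq> q" by blast
  obtain u v t where t: "t > 0" "\<And>i j. t \<le> dist ((f ^^ i) u) ((f ^^ j) v)"
    by (rule separated_orbits[OF compact_UNIV continuous_f gap \<open>p \<noteq> q\<close>]) blast+
  obtain nh xh where nh: "\<And>n0. nh n0 \<ge> n0"
    and xh: "\<And>n0 y. (\<And>i. i \<le> nh n0 \<Longrightarrow> dist ((f ^^ i) (xh n0)) ((f ^^ i) y)
      \<le> \<delta>h * exp (- lam * real (min i (nh n0 - i)))) \<Longrightarrow> b * real (nh n0) - ch \<le> \<phi> (nh n0) y"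
    using high by metis
  obtain xl where xl: "\<And>n y. n \<ge> n1 \<Longrightarrow> (\<And>i. i \<le> n \<Longrightarrow> dist ((f ^^ i) (xl n)) ((f ^^ i) y) \<le> \<delta>l)
      \<Longrightarrow> \<phi> n y \<le> a * real n + cl"
    using low by metis
  \<comment> \<open>Halved because \<open>spec_gap_shadowing\<close> produces errors up to 2 *
    \<delta>.\<close>
  define \<delta> where "\<delta> = min \<delta>h \<delta>l / 2"
  have \<delta>: "\<delta> > 0" using \<delta>h \<delta>l by (simp add: \<delta>_def)
  have "\<exists>N. spec_gap f lam (\<delta> / 2^k) N" for k :: nat using gap \<delta> by simp
  then obtain G where G: "\<And>k :: nat. spec_gap f lam (\<delta> / 2^k) (G k)" by metis
  have G0: "G k > 0" for k using G[of k] by (simp add: spec_gap_def)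
  \<comment> \<open>The multiple k of the elapsed time makes the block outweigh its past,
    \<open>Suc\<close> pays for the additive constants ch and cl, and n1 admits the length in
    \<open>low\<close>.\<close>
  define len where "len k s = (if k mod 3 = 0 then nh (k * Suc s + n1) else k * Suc s + n1)" for k s :: nat
  define Ns where "Ns = rec_nat 0 (\<lambda>k s. s + len k s + G (Suc k))"
  have Ns: "Ns 0 = 0" "Ns (Suc k) = Ns k + len k (Ns k) + G (Suc k)" for k
    by (simp_all add: Ns_def)
  define Ms where "Ms k = len k (Ns k)" for k
  define base where "base k = k * Suc (Ns k) + n1" for k
  have Mslen: "base k \<le> Ms k" for k
    using nh by (simp add: Ms_def len_def base_def)
  define T where "T k = Ns k + Ms k" for k
  \<comment> \<open>Decoding k div 3 as a pair uses every bit of \<xi> in infinitely many blocks.\<close>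
  define xs where "xs \<xi> k = (if k mod 3 = 0 then xh (base k) else if k mod 3 = 1 then xl (base k)
    else if \<xi> (fst (prod_decode (k div 3))) then u else v)" for \<xi> :: "nat \<Rightarrow> bool" and k
  have "\<exists>y. \<forall>k. \<forall>i\<le>Ms k. dist ((f ^^ i) (xs \<xi> k)) ((f ^^ (Ns k + i)) y)
      \<le> (2 * \<delta> / 2^k) * exp (- lam * real (min i (Ms k - i)))" for \<xi>
    by (rule spec_gap_shadowing[OF compact_UNIV continuous_f lam \<delta> G]) (simp_all add: Ns Ms_def)
  then obtain Y where Y: "\<And>\<xi> k i. i \<le> Ms k \<Longrightarrow> dist ((f ^^ i) (xs \<xi> k)) ((f ^^ (Ns k + i)) (Y \<xi>))
      \<le> (2 * \<delta> / 2^k) * exp (- lam * real (min i (Ms k - i)))" by metis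
  have \<delta>k: "2 * \<delta> / 2^k * exp (- lam * real j) \<le> 2 * \<delta> / 2^k" for k j :: nat
    using \<delta> lam by (intro mult_left_le) auto
  have Y': "dist ((f ^^ i) (xs \<xi> k)) ((f ^^ i) ((f ^^ Ns k) (Y \<xi>))) \<le> (2 * \<delta> / 2^k) * exp (- lam * real (min i (Ms k - i)))"
    if "i \<le> Ms k" for i k \<xi>
    using Y[OF that] by (simp add: funpow_add add.commute[of "Ns k"])
  have \<delta>1: "2 * \<delta> / 2^k \<le> 2 * \<delta>" for k :: nat
    using \<delta> by (simp add: divide_le_eq mult_le_cancel_left1 one_le_power)
  have "\<not> convergent (\<lambda>n. \<phi> n (Y \<xi>) / real n)" for \<xi>
  proof (rule not_convergent_if_two_limits[where a = a and b = b])
    \<comment> \<open>D * (Ns k + 1) covers the influence of the Ns k times before the block and the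
      additive constant of the segment.\<close>
    define D where "D = K + \<bar>a\<bar> + \<bar>b\<bar> + \<bar>cl\<bar> + \<bar>ch\<bar>"
    have T: "c \<le> T k" "(real (Ns k) + 1) / real (T k) \<le> 1 / real c" "real (T k) > 0" if "c \<ge> 1" "k \<ge> c" for c k
    proof -
      have "c * Suc (Ns k) \<le> k * Suc (Ns k)" using that by (intro mult_right_mono) auto
      also have "\<dots> \<le> T k" using Mslen[of k] by (simp add: T_def base_def)
      finally have le: "c * Suc (Ns k) \<le> T k" .
      then have 1: "real c * (real (Ns k) + 1) \<le> real (T k)"
        by (metis of_nat_Suc of_nat_mult of_nat_mono add.commute)
      show "c \<le> T k" using le by simp
      then show "real (T k) > 0" using that by linarith
      then show "(real (Ns k) + 1) / real (T k) \<le> 1 / real c"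
        using 1 that by (simp add: field_simps)
    qed
    show "filterlim (\<lambda>c. T (3 * c)) at_top sequentially" "filterlim (\<lambda>c. T (3 * c + 1)) at_top sequentially"
    proof -
      have "c \<le> T (3 * c)" "c \<le> T (3 * c + 1)" for c using T(1)[of c] by (cases "c = 0"; simp)+
      then show "filterlim (\<lambda>c. T (3 * c)) at_top sequentially" "filterlim (\<lambda>c. T (3 * c + 1)) at_top sequentially"
        by (auto intro!: filterlim_at_top_mono[OF filterlim_ident])
    qed
    have D: "D \<ge> 0" using K_nonneg by (simp add: D_def)
    have DT: "D * (real (Ns k) + 1) / real (T k) \<le> D / real c" if "c \<ge> 1" "k \<ge> c" for c k
      using mult_left_mono[OF T(2)[OF that] D] by simp
    fix c :: nat assume c: "c \<ge> 1"
    show "b - D / real c \<le> \<phi> (T (3 * c)) (Y \<xi>) / real (T (3 * c))"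
    proof -
      define k where "k = 3 * c"
      have k: "k \<ge> c" "k mod 3 = 0" by (auto simp: k_def)
      have Msk: "Ms k = nh (base k)" "xs \<xi> k = xh (base k)" using k by (simp_all add: Ms_def len_def base_def xs_def)
      have "b * real (Ms k) - ch \<le> \<phi> (Ms k) ((f ^^ Ns k) (Y \<xi>))"
        unfolding Msk(1)
      proof (rule xh)
        fix i assume "i \<le> nh (base k)"
        then have "i \<le> Ms k" by (simp add: Msk)
        from Y'[OF this, of \<xi>] show "dist ((f ^^ i) (xh (base k))) ((f ^^ i) ((f ^^ Ns k) (Y \<xi>)))
          \<le> \<delta>h * exp (- lam * real (min i (nh (base k) - i)))"
        proof (unfold Msk, elim order_trans, intro mult_right_mono)
          show "2 * \<delta> / 2^k \<le> \<delta>h" using \<delta>1[of k] by (simp add: \<delta>_def)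
        qed simp
      qed
      also have "\<dots> \<le> \<phi> (T k) (Y \<xi>) + K * real (Ns k)" unfolding T_def by (rule tail_le_funpow)
      finally have "b * real (Ms k) - ch - K * real (Ns k) \<le> \<phi> (T k) (Y \<xi>)" by simp
      moreover have "b * real (T k) - D * (real (Ns k) + 1) \<le> b * real (Ms k) - ch - K * real (Ns k)"
      proof -
        have "(b + K) * real (Ns k) \<le> D * real (Ns k)" by (intro mult_right_mono) (auto simp: D_def)
        moreover have "ch \<le> D" using K_nonneg by (simp add: D_def)
        ultimately show ?thesis by (simp add: T_def algebra_simps)
      qed
      ultimately have "(b * real (T k) - D * (real (Ns k) + 1)) / real (T k) \<le> \<phi> (T k) (Y \<xi>) / real (T k)"
        by (intro divide_right_mono) auto
      then have "b - D * (real (Ns k) + 1) / real (T k) \<le> \<phi> (T k) (Y \<xi>) / real (T k)"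
        using T(3)[OF c k(1)] by (simp add: diff_divide_distrib)
      then show ?thesis using DT[OF c k(1)] unfolding k_def by linarith
    qed
    show "\<phi> (T (3 * c + 1)) (Y \<xi>) / real (T (3 * c + 1)) \<le> a + D / real c"
    proof -
      define k where "k = 3 * c + 1"
      have k: "k \<ge> c" "k mod 3 = 1" by (simp_all add: k_def)
      have Msk: "Ms k = base k" "xs \<xi> k = xl (base k)" using k by (simp_all add: Ms_def len_def base_def xs_def)
      have "\<phi> (T k) (Y \<xi>) \<le> \<phi> (Ns k) (Y \<xi>) + \<phi> (Ms k) ((f ^^ Ns k) (Y \<xi>))"
        unfolding T_def by (rule subadditive)
      also have "\<dots> \<le> K * real (Ns k) + (a * real (Ms k) + cl)"
      proof (intro add_mono upper_bounded)
        show "\<phi> (Ms k) ((f ^^ Ns k) (Y \<xi>)) \<le> a * real (Ms k) + cl"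
          unfolding Msk(1)
        proof (rule xl)
          fix i assume "i \<le> base k"
          then have i: "i \<le> Ms k" by (simp add: Msk)
          have "dist ((f ^^ i) (xl (base k))) ((f ^^ i) ((f ^^ Ns k) (Y \<xi>))) \<le> 2 * \<delta> / 2^k"
            using order_trans[OF Y'[OF i, of \<xi>] \<delta>k] by (simp add: Msk)
          also have "\<dots> \<le> \<delta>l" using \<delta>1[of k] by (simp add: \<delta>_def)
          finally show "dist ((f ^^ i) (xl (base k))) ((f ^^ i) ((f ^^ Ns k) (Y \<xi>))) \<le> \<delta>l" .
        qed (simp add: base_def)
      qed
      also have "\<dots> \<le> a * real (T k) + D * (real (Ns k) + 1)"
      proof -
        have "(K - a) * real (Ns k) \<le> D * real (Ns k)" by (intro mult_right_mono) (auto simp: D_def)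
        moreover have "cl \<le> D" using K_nonneg by (simp add: D_def)
        ultimately show ?thesis by (simp add: T_def algebra_simps)
      qed
      finally have "\<phi> (T k) (Y \<xi>) / real (T k) \<le> (a * real (T k) + D * (real (Ns k) + 1)) / real (T k)"
        by (intro divide_right_mono) auto
      then have "\<phi> (T k) (Y \<xi>) / real (T k) \<le> a + D * (real (Ns k) + 1) / real (T k)"
        using T(3)[OF c k(1)] by (simp add: add_divide_distrib)
      then show ?thesis using DT[OF c k(1)] unfolding k_def by linarith
    qed
  qed (rule ab)
  moreover have far: "\<exists>k\<ge>c0. \<forall>i. Ns k \<le> i \<longrightarrow> i \<le> Ns k + Ms k \<longrightarrow> t / 2 \<le> dist ((f ^^ i) (Y \<xi>)) ((f ^^ i) (Y \<eta>))"
    if neq: "\<xi> \<noteq> \<eta>" for \<xi> \<eta> c0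
  proof -
    obtain j where j: "\<xi> j \<noteq> \<eta> j" using neq by blast
    \<comment> \<open>Shadowing errors of t / 4 for each of the two orbits leave t / 2 of the
      separation t.\<close>
    obtain M :: nat where M: "(1/2)^M < t / (8 * \<delta>)" using real_arch_pow_inv[of "t / (8 * \<delta>)" "1/2"] t \<delta> by auto
    define m where "m = prod_encode (j, max M c0)"
    have m: "m \<ge> max M c0" unfolding m_def by (rule le_prod_encode_2)
    define k where "k = 3 * m + 2"
    have k: "k mod 3 = 2" "k div 3 = m" "k \<ge> m" unfolding k_def by presburger+
    have uv: "xs \<xi> k = (if \<xi> j then u else v)" for \<xi> using k by (simp add: xs_def m_def)
    have tk: "2 * \<delta> / 2^k \<le> t / 4"
    proof -
      have "(1/2::real)^k \<le> (1/2)^M" using m k(3) by (intro power_decreasing) auto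
      then have "(1/2::real)^k \<le> t / (8 * \<delta>)" using M by linarith
      then show ?thesis using \<delta> by (simp add: field_simps power_one_over)
    qed
    have "t / 2 \<le> dist ((f ^^ i) (Y \<xi>)) ((f ^^ i) (Y \<eta>))" if i: "Ns k \<le> i" "i \<le> Ns k + Ms k" for i
    proof -
      define l where "l = i - Ns k"
      have l: "l \<le> Ms k" "i = Ns k + l" using i by (auto simp: l_def)
      have 1: "dist ((f ^^ l) (xs \<xi> k)) ((f ^^ i) (Y \<xi>)) \<le> t / 4" for \<xi>
        using order_trans[OF order_trans[OF Y[OF l(1), of \<xi>] \<delta>k] tk] l(2) by simp
      have "t \<le> dist ((f ^^ l) (xs \<xi> k)) ((f ^^ l) (xs \<eta> k))"
        using j t(2)[of l l] by (auto simp: uv dist_commute)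
      also have "\<dots> \<le> dist ((f ^^ l) (xs \<xi> k)) ((f ^^ i) (Y \<xi>)) + dist ((f ^^ i) (Y \<xi>)) ((f ^^ i) (Y \<eta>))
          + dist ((f ^^ l) (xs \<eta> k)) ((f ^^ i) (Y \<eta>))"
        using dist_triangle[of "(f ^^ l) (xs \<xi> k)" "(f ^^ l) (xs \<eta> k)" "(f ^^ i) (Y \<xi>)"]
          dist_triangle[of "(f ^^ i) (Y \<xi>)" "(f ^^ l) (xs \<eta> k)" "(f ^^ i) (Y \<eta>)"]
        by (simp add: dist_commute)
      finally show ?thesis using 1[of \<xi>] 1[of \<eta>] by linarith
    qed
    moreover have "k \<ge> c0" using m k(3) by linarith
    ultimately show ?thesis by blast
  qed
  have near: "\<exists>k\<ge>c0. \<forall>i. Ns k \<le> i \<longrightarrow> i \<le> Ns k + Ms k \<longrightarrow> dist ((f ^^ i) (Y \<xi>)) ((f ^^ i) (Y \<eta>)) < e"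
    if e: "e > 0" for \<xi> \<eta> e and c0 :: nat
  proof -
    obtain M :: nat where M: "(1/2)^M < e / (4 * \<delta>)" using real_arch_pow_inv[of "e / (4 * \<delta>)" "1/2"] e \<delta> by auto
    define k where "k = 3 * max M c0"
    have k: "k mod 3 = 0" "k \<ge> M" "k \<ge> c0" by (auto simp: k_def)
    have ek: "2 * \<delta> / 2^k < e / 2"
    proof -
      have "(1/2::real)^k \<le> (1/2)^M" using k(2) by (intro power_decreasing) auto
      then have "(1/2::real)^k < e / (4 * \<delta>)" using M by linarith
      then show ?thesis using \<delta> by (simp add: field_simps power_one_over)
    qed
    have "dist ((f ^^ i) (Y \<xi>)) ((f ^^ i) (Y \<eta>)) < e" if i: "Ns k \<le> i" "i \<le> Ns k + Ms k" for i
    proof -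
      define l where "l = i - Ns k"
      have l: "l \<le> Ms k" "i = Ns k + l" using i by (auto simp: l_def)
      have "dist ((f ^^ l) (xh (base k))) ((f ^^ i) (Y \<xi>)) < e / 2" for \<xi>
        using le_less_trans[OF order_trans[OF Y[OF l(1), of \<xi>] \<delta>k] ek] l(2) k(1) by (simp add: xs_def)
      then show ?thesis by (metis dist_triangle_half_r)
    qed
    then show ?thesis using k(3) by blast
  qed
  have DC1: "DC1_pair f (Y \<xi>) (Y \<eta>)" if "\<xi> \<noteq> \<eta>" for \<xi> \<eta>
  proof (rule DC1_pair_of_blocks[where Ns = Ns and Ms = Ms and t = "t / 2"])
    show "k * Suc (Ns k) \<le> Ms k" for k using Mslen[of k] by (simp add: base_def)
  qed (use t(1) near far[OF that] in auto)
  have "inj Y"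
  proof (rule injI, rule ccontr)
    fix \<xi> \<eta> assume eq: "Y \<xi> = Y \<eta>" and "\<xi> \<noteq> \<eta>"
    from far[OF this(2), of 0] obtain k where "t / 2 \<le> dist ((f ^^ Ns k) (Y \<xi>)) ((f ^^ Ns k) (Y \<eta>))" by auto
    then show False using eq t(1) by simp
  qed
  then have "uncountable (range Y)"
    using uncountable_nat_bool by (simp add: countable_image_inj_eq)
  moreover have "DC1_scrambled f (range Y)" by (auto simp: DC1_scrambled_def intro!: DC1)
  ultimately show ?thesis by (intro exI[of _ "range Y"]) auto
qed

end

theorem theorem4p1:
  fixes f :: "'a::metric_space \<Rightarrow> 'a"
    and A :: "'a \<Rightarrow> real^'m^'m"
    and \<alpha> :: real
  assumes "compact (UNIV :: 'a set)"
    and "continuous_on UNIV f"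
    and "exp_specification f"
    and "\<And>x. invertible (A x)"
    and "\<alpha> > 0"
    and "\<exists>C. \<forall>x y. norm (A x - A y) \<le> C * dist x y powr \<alpha>"
    and "(INF \<mu>\<in>{\<mu>. ergodic_measure f \<mu>}. chi_max_measure A f \<mu>)
           < (SUP \<mu>\<in>{\<mu>. ergodic_measure f \<mu>}. chi_max_measure A f \<mu>)"
  shows "\<exists>S. S \<subseteq> MLI A f \<and> uncountable S \<and> DC1_scrambled f S"
proof -
  obtain C where "\<And>x y. norm (A x - A y) \<le> C * dist x y powr \<alpha>" using assms(6) by blast
  then obtain B :: "'a \<Rightarrow> (real^'m) \<Rightarrow>\<^sub>L (real^'m)" and H
    where lc: "linear_cocycle f B H \<alpha>" and op: "\<And>n x. norm (op_cocycle B f n x) = opnorm (cocycle A f n x)"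
    by (rule linear_cocycle_of_matrices[OF assms(1,2,5,4)]) blast
  interpret linear_cocycle f B H \<alpha> by (rule lc)
  obtain K where "bounded_subadditive_cocycle f \<phi> K" by (rule bounded_subadditive)
  then interpret bounded_subadditive_cocycle f \<phi> K .
  have lyap: "lyap_seq A f x = (\<lambda>n. \<phi> n x / real n)" for x
    by (simp add: fun_eq_iff lyap_seq_def \<phi>_def op)
  obtain lam where lam: "lam > 0" and gap: "\<And>\<delta>. \<delta> > 0 \<Longrightarrow> \<exists>N. spec_gap f lam \<delta> N"
    using assms(3) unfolding exp_specification_iff_spec_gap by blast
  have "\<exists>\<mu> N. ergodic_measure f \<mu> \<and> N \<ge> 1 \<and> (\<integral>x. \<phi> N x \<partial>\<mu>) < growth * real N"
  proof (rule ccontr)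
    assume contra: "\<not> ?thesis"
    have "chi_max_measure A f \<mu> = growth" if erg: "ergodic_measure f \<mu>" for \<mu>
    proof -
      have lim: "AE x in \<mu>. (\<lambda>n. \<phi> n x / real n) \<longlonglongrightarrow> growth"
        using contra erg by (intro ergodic_limit[OF erg]) (auto simp: not_less)
      interpret prob_space \<mu> using erg by (simp add: ergodic_measure_def invariant_measure_def)
      show ?thesis unfolding chi_max_measure_def lyap
      proof (rule the_equality)
        show "AE x in \<mu>. (\<lambda>n. \<phi> n x / real n) \<longlonglongrightarrow> growth" by (rule lim)
        \<comment> \<open>In a probability space a constant statement true almost everywhere is
          true, so the value behind \<open>THE\<close> is unique.\<close>
        fix c assume "AE x in \<mu>. (\<lambda>n. \<phi> n x / real n) \<longlonglongrightarrow> c"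
        with lim have "AE x in \<mu>. c = growth"
          by eventually_elim (blast intro: LIMSEQ_unique)
        then show "c = growth" by simp
      qed
    qed
    moreover have "{\<mu>. ergodic_measure f \<mu>} \<noteq> {}" using ergodic_measure_exists[OF assms(1,2)] by blast
    ultimately have "chi_max_measure A f ` {\<mu>. ergodic_measure f \<mu>} = {growth}" by auto
    then show False using assms(7) by simp
  qed
  then obtain \<mu> N where erg: "ergodic_measure f \<mu>" and N: "N \<ge> 1" and int: "(\<integral>x. \<phi> N x \<partial>\<mu>) < growth * real N" by blast
  obtain a where a: "(\<integral>x. \<phi> N x \<partial>\<mu>) / real N < a" "a < growth"
    using dense[of "(\<integral>x. \<phi> N x \<partial>\<mu>) / real N" growth] int N by (auto simp: field_simps)
  \<comment> \<open>The first entry keeps b above a, the second keeps it close enough to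
    \<open>growth\<close> for \<open>high_growth_segments\<close>.\<close>
  define b where "b = max ((a + growth) / 2) (growth - lam * \<alpha> / 4)"
  have b: "a < b" "b < growth" "growth - b \<le> lam * \<alpha> / 4"
  proof -
    have "lam * \<alpha> / 4 > 0" using lam assms(5) by simp
    then show "b < growth" using a by (simp add: b_def)
    have "(a + growth) / 2 \<le> b" "growth - lam * \<alpha> / 4 \<le> b" by (simp_all only: b_def max.cobounded1 max.cobounded2)
    then show "a < b" "growth - b \<le> lam * \<alpha> / 4" using a by (simp_all add: field_simps)
  qed
  obtain \<delta>l cl where \<delta>l: "\<delta>l > 0" and low: "\<And>n. \<exists>x. \<forall>y. (\<forall>i\<le>N + n. dist ((f ^^ i) x) ((f ^^ i) y) \<le> \<delta>l)
      \<longrightarrow> \<phi> (N + n) y \<le> a * real n + cl"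
    by (rule low_growth_segments[of \<mu> N a]) (use erg N a in \<open>auto simp: ergodic_measure_def field_simps\<close>)
  \<comment> \<open>Segments of length N + n are controlled by a * n, so in terms of the full length
    the constant becomes cl - a * N.\<close>
  have low': "\<exists>x. \<forall>y. (\<forall>i\<le>n. dist ((f ^^ i) x) ((f ^^ i) y) \<le> \<delta>l) \<longrightarrow> \<phi> n y \<le> a * real n + (cl - a * real N)"
    if "n \<ge> N" for n
    using low[of "n - N"] that by (simp add: of_nat_diff algebra_simps)
  obtain \<delta>h where \<delta>h: "\<delta>h > 0" and high: "\<And>n0. \<exists>n\<ge>n0. \<exists>x. \<forall>y.
    (\<forall>i\<le>n. dist ((f ^^ i) x) ((f ^^ i) y) \<le> \<delta>h * exp (- lam * real (min i (n - i)))) \<longrightarrow>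
      exp (b * real n) / 2 \<le> norm (op_cocycle B f n y)"
  proof (rule high_growth_segments[OF \<alpha>_pos hoelder lam _ _ b(2,3)])
    fix \<epsilon> :: real assume "\<epsilon> > 0"
    then obtain c where c: "\<And>n x. \<phi> n x \<le> (growth + \<epsilon>) * real n + c" by (rule growth_upper) blast
    have "norm (op_cocycle B f n x) \<le> exp c * exp ((growth + \<epsilon>) * real n)" for n x
      unfolding norm_op_cocycle_eq_exp exp_add[symmetric] using c[of n x] by (simp add: add.commute)
    then show "\<exists>C. \<forall>n x. norm (op_cocycle B f n x) \<le> C * exp ((growth + \<epsilon>) * real n)" by blast
  next
    fix n :: nat assume "n \<ge> 1"
    then show "\<exists>x. exp (growth * real n) \<le> norm (op_cocycle B f n x)"
      unfolding norm_op_cocycle_eq_exp exp_le_cancel_iff by (metis growth_attained)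
  qed blast
  have "exp (b * real n) / 2 \<le> norm (op_cocycle B f n y) \<longleftrightarrow> b * real n - ln 2 \<le> \<phi> n y" for n y
  proof -
    have "exp (b * real n) / 2 = exp (b * real n - ln 2)" by (simp add: exp_diff)
    then show ?thesis by (simp add: norm_op_cocycle_eq_exp)
  qed
  with high have high': "\<And>n0. \<exists>n\<ge>n0. \<exists>x. \<forall>y.
    (\<forall>i\<le>n. dist ((f ^^ i) x) ((f ^^ i) y) \<le> \<delta>h * exp (- lam * real (min i (n - i)))) \<longrightarrow>
      b * real n - ln 2 \<le> \<phi> n y" by simp
  have "\<exists>S. S \<subseteq> {x. \<not> convergent (\<lambda>n. \<phi> n x / real n)} \<and> uncountable S \<and> DC1_scrambled f S"
    by (rule uncountable_irregular_scrambled_set[OF lam gap b(1) \<delta>h \<delta>l high' low'])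
  then show ?thesis unfolding MLI_def lyap .
qed

end
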